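(* Let $1<p<\infty$ and $q>p-1$, and let $(V,E,\mu)$ be an infinite, connected, locally finite weighted graph which is not $p$-parabolic. If $$\sum_{n=1}^{\infty}\frac{n^{\frac{pq}{p-1}-1}}{\mu(B(o,n))^{\frac{q-p+1}{p-1}}}=\infty$$ for some vertex $o\in V$, then every nonnegative solution $u:V\to[0,\infty)$ of $$-\Delta_p u(x)\ge u(x)^q\qquad\text{for all }x\in V$$ is identically zero.
   Context: Weighted graph: $V$ is the vertex set, $E$ the edge set; edge weights satisfy $\mu_{xy}=\mu_{yx}>0$ if $x\sim y$ (i.e. $\{x,y\}\in E$), and the vertex measure is $\mu(x)=\sum_{y\sim x}\mu_{xy}$, with $\mu(A)=\sum_{x\in A}\mu(x)$ for $A\subset V$. Write $\Phi_p(t)=|t|^{p-2}t$ (with $\Phi_p(0)=0$). The normalized $p$-Laplacian is $$\Delta_p u(x)=\frac1{\mu(x)}\sum_{y\sim x}\mu_{xy}\Phi_p(u(y)-u(x)).$$ The graph distance $d(x,y)$ is the minimal number of edges of a path connecting $x$ and $y$, and $B(o,r)=\{x\in V: d(o,x)\le r\}$. For a finite nonempty $A\subset V$, $\operatorname{cap}_p(A)=\inf\{\sum_{\{x,y\}\in E}\mu_{xy}|v(x)-v(y)|^p : v \text{ finitely supported on }V,\ v\ge 1\text{ on }A\}$. The graph is called $p$-parabolic if $\operatorname{cap}_p(A)=0$ for every finite nonempty $A\subset V$. *)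

theory Defs
  imports "HOL-Analysis.Analysis"
begin

(* An edge is an unordered pair {x, y}. Loops {x, x} = {x} are not excluded: they count
   in the vertex measure and contribute nothing to the p-Laplacian and the energy.
   The weight w x y is only ever used for edges {x, y}. *)
locale weighted_graph =
  fixes V :: "'a set" and E :: "'a set set" and w :: "'a \<Rightarrow> 'a \<Rightarrow> real"
  assumes edge_ends: "e \<in> E \<Longrightarrow> \<exists>x\<in>V. \<exists>y\<in>V. e = {x, y}"
    and weight_sym: "{x, y} \<in> E \<Longrightarrow> w x y = w y x"
    and weight_pos: "{x, y} \<in> E \<Longrightarrow> w x y > 0"

definition neighbours :: "'a set set \<Rightarrow> 'a \<Rightarrow> 'a set" where
  "neighbours E x = {y. {x, y} \<in> E}"

definition adjacency :: "'a set set \<Rightarrow> ('a \<times> 'a) set" where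
  "adjacency E = {(x, y). {x, y} \<in> E}"

definition locally_finite_graph :: "'a set \<Rightarrow> 'a set set \<Rightarrow> bool" where
  "locally_finite_graph V E \<longleftrightarrow> (\<forall>x\<in>V. finite (neighbours E x))"

definition connected_graph :: "'a set \<Rightarrow> 'a set set \<Rightarrow> bool" where
  "connected_graph V E \<longleftrightarrow> (\<forall>x\<in>V. \<forall>y\<in>V. (x, y) \<in> (adjacency E)\<^sup>*)"

(* Meaningful for vertices joined by a path. *)
definition graph_dist :: "'a set set \<Rightarrow> 'a \<Rightarrow> 'a \<Rightarrow> nat" where
  "graph_dist E x y = (LEAST n. (x, y) \<in> adjacency E ^^ n)"

definition graph_ball :: "'a set \<Rightarrow> 'a set set \<Rightarrow> 'a \<Rightarrow> nat \<Rightarrow> 'a set" where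
  "graph_ball V E z r = {x \<in> V. graph_dist E z x \<le> r}"

definition vertex_measure :: "'a set set \<Rightarrow> ('a \<Rightarrow> 'a \<Rightarrow> real) \<Rightarrow> 'a \<Rightarrow> real" where
  "vertex_measure E w x = (\<Sum>y\<in>neighbours E x. w x y)"

(* Used for finite A only. *)
definition set_measure :: "'a set set \<Rightarrow> ('a \<Rightarrow> 'a \<Rightarrow> real) \<Rightarrow> 'a set \<Rightarrow> real" where
  "set_measure E w A = (\<Sum>x\<in>A. vertex_measure E w x)"

definition Phi :: "real \<Rightarrow> real \<Rightarrow> real" where
  "Phi p t = \<bar>t\<bar> powr (p - 2) * t"

definition p_laplacian ::
  "'a set set \<Rightarrow> ('a \<Rightarrow> 'a \<Rightarrow> real) \<Rightarrow> real \<Rightarrow> ('a \<Rightarrow> real) \<Rightarrow> 'a \<Rightarrow> real" where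
  "p_laplacian E w p u x =
     1 / vertex_measure E w x * (\<Sum>y\<in>neighbours E x. w x y * Phi p (u y - u x))"

(* The sum over unordered edges is written as half the sum over ordered pairs: every edge
   that is not a loop occurs twice, and loops contribute 0. On a locally finite graph only
   finitely many terms are nonzero if v has finite support. *)
definition p_energy ::
  "'a set set \<Rightarrow> ('a \<Rightarrow> 'a \<Rightarrow> real) \<Rightarrow> real \<Rightarrow> ('a \<Rightarrow> real) \<Rightarrow> real" where
  "p_energy E w p v =
     (\<Sum>\<^sub>\<infinity>(x, y)\<in>adjacency E. w x y * \<bar>v x - v y\<bar> powr p) / 2"

definition p_capacity ::
  "'a set \<Rightarrow> 'a set set \<Rightarrow> ('a \<Rightarrow> 'a \<Rightarrow> real) \<Rightarrow> real \<Rightarrow> 'a set \<Rightarrow> real" where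
  "p_capacity V E w p A =
     Inf {p_energy E w p v | v. finite {x \<in> V. v x \<noteq> 0} \<and> (\<forall>x\<in>A. v x \<ge> 1)}"

definition p_parabolic ::
  "'a set \<Rightarrow> 'a set set \<Rightarrow> ('a \<Rightarrow> 'a \<Rightarrow> real) \<Rightarrow> real \<Rightarrow> bool" where
  "p_parabolic V E w p \<longleftrightarrow>
     (\<forall>A. A \<subseteq> V \<and> finite A \<and> A \<noteq> {} \<longrightarrow> p_capacity V E w p A = 0)"

end

theory Submission
  imports Defs
begin

text \<open>
  If $u$ vanishes at one vertex, the inequality at that vertex forces it to vanish at all
  neighbours, hence everywhere (\<open>zero_propagates\<close>). So suppose $u > 0$. The proof compares the mass
  $J(r) = \sum_{d(z,x) < r} \mu(x) u(x)^q$ with the volume $W(n) = \mu(B(z,n))$, and derives from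
  the existence of $u$ that the series in the theorem converges. Put $\theta = q/(p-1) > 1$.

  The core is the growth estimate \<open>mass_growth\<close>: for $h \ge 1$ and $n \ge r + 4h$,
  \[ J(r+4h) - J(r) \ge c\, W(n) \bigl(J(r) h^p / W(n)\bigr)^\theta. \]
  Testing the inequality with a cutoff that falls from 1 to 0 across the annulus
  $r+h \le d(z,\cdot) \le r+2h$ shows that $J(r)$ is at most the flux $\frac1h \sum |\nabla u|^{p-1}$
  over the edges of the annulus (\<open>flux_through_annulus\<close>). Hoelder's inequality splits the flux into
  the energy $\sum |\nabla u|^p u^{-1-\epsilon}$, which a Caccioppoli inequality bounds by
  $h^{-p} \sum \mu u^{p-1-\epsilon}$ over a slightly larger annulus, and the sum
  $\sum \mu u^{(1+\epsilon)(p-1)}$. For small $\epsilon$ both exponents are below $q$, so a second use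
  of Hoelder's inequality bounds everything by $\sum \mu u^q$ over the larger annulus and by the
  volume. On a graph the values of $u$ at the ends of an edge need not be comparable; the
  Caccioppoli inequality survives with $u$ replaced by the larger of the two values
  (\<open>caccioppoli_pointwise\<close>).

  The growth estimate alone allows $J$ to grow doubly exponentially along $r = 16^k$. This is
  excluded by an a priori bound: the equation at a single vertex gives $u \le 1$, so
  $J \le W$, and applying the growth estimate with the step lengths $h, h/2, h/4, \dots, 1$ yields
  $J(r) h^{p\theta/(\theta-1)} \le K\, W(n)$ for $n \ge r + 8h$ (\<open>dyadic_mass_bound\<close>). With both
  estimates, $b_k = 16^{kp\theta} W(16^{k+1})^{1-\theta}$ is at most a constant times
  $J(16^k)^{1-\theta} - J(16^{k+1})^{1-\theta}$, so $\sum b_k$ telescopes to a finite bound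
  (\<open>dyadic_volume_sum_bounded\<close>), and Cauchy condensation (\<open>sum_le_condensed_sum\<close>) carries this
  over to the series in the theorem.
\<close>

section \<open>Power inequalities\<close>

text \<open>The decreasing convex function $x \mapsto x^{-e}$ lies above its tangent at the larger point.\<close>
lemma powr_neg_diff_ge:
  fixes a b e :: real
  assumes "0 < b" "b \<le> a" "0 \<le> e"
  shows "e * a powr (- 1 - e) * (a - b) \<le> b powr (- e) - a powr (- e)"
proof -
  define x where "x = b / a"
  have x: "0 < x" "x \<le> 1" and b: "b = x * a" and a: "0 < a"
    using assms by (auto simp: x_def)
  have "e * (1 - x) \<le> - e * ln x"
    using ln_le_minus_one[of x] mult_left_mono[of "1 - x" "- ln x" e] x assms by simp
  also have "1 + (- e * ln x) \<le> exp (- e * ln x)"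
    by (rule exp_ge_add_one_self)
  then have "- e * ln x \<le> x powr (- e) - 1"
    using x by (simp add: powr_def)
  finally have 1: "e * (1 - x) * a powr (- e) \<le> (x powr (- e) - 1) * a powr (- e)"
    by (intro mult_right_mono) auto
  have "a powr (- 1 - e) * (a - b) = (1 - x) * a powr (- e)"
    using a by (simp add: b powr_diff powr_minus divide_simps) (simp add: algebra_simps)
  then have 2: "e * a powr (- 1 - e) * (a - b) = e * (1 - x) * a powr (- e)"
    by (simp add: mult.assoc)
  have 3: "b powr (- e) = x powr (- e) * a powr (- e)"
    using a x by (simp add: b powr_mult)
  show ?thesis
    unfolding 2 3 using 1 by (simp add: left_diff_distrib)
qed

lemma powr_diff_le:
  fixes x y p :: real
  assumes "1 \<le> p" "0 \<le> y" "y \<le> x"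
  shows "x powr p - y powr p \<le> p * x powr (p - 1) * (x - y)"
proof (cases "y = 0 \<or> x = y")
  case True
  have "x powr p = x powr (p - 1) * x"
    using assms by (cases "x = 0") (simp_all add: powr_diff)
  then have "x powr p \<le> p * x powr (p - 1) * x"
    using assms mult_right_mono[of 1 p "x powr (p - 1) * x"] by simp
  then show ?thesis using True assms by auto
next
  case False
  with assms have xy: "0 < y" "y < x" by auto
  obtain c where c: "y < c" "c < x" "x powr p - y powr p = (x - y) * (p * c powr (p - 1))"
    using MVT2[OF xy(2), of "\<lambda>t. t powr p" "\<lambda>t. p * t powr (p - 1)"] xy
    by (metis has_real_derivative_powr order_less_le_trans)
  have "c powr (p - 1) \<le> x powr (p - 1)"
    using c xy assms by (intro powr_mono2) auto
  then have "(x - y) * (p * c powr (p - 1)) \<le> (x - y) * (p * x powr (p - 1))"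
    using xy assms by (intro mult_left_mono) auto
  then show ?thesis using c(3) by (simp add: mult_ac)
qed

lemma powr_pred_mult_self:
  fixes x p :: real
  assumes "0 \<le> x"
  shows "x powr (p - 1) * x = x powr p"
  using assms by (cases "x = 0") (simp_all add: powr_diff)

text \<open>Young's inequality for $s^{p-1} t$ with a free weight and without sharp constants.\<close>
lemma weighted_young:
  fixes s t d p :: real
  assumes "1 < p" "0 \<le> s" "0 \<le> t" "0 < d"
  shows "s powr (p - 1) * t \<le> d * s powr p + d powr (1 - p) * t powr p"
proof (cases "t \<le> d * s")
  case True
  have "s powr (p - 1) * t \<le> s powr (p - 1) * (d * s)"
    using True by (intro mult_left_mono) auto
  also have "\<dots> = d * s powr p"
    using powr_pred_mult_self[of s p] assms by (simp add: mult_ac)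
  finally show ?thesis by (smt (verit) powr_ge_zero mult_nonneg_nonneg)
next
  case False
  then have "s powr (p - 1) \<le> (t / d) powr (p - 1)"
    using assms by (intro powr_mono2) (auto simp: field_simps)
  then have "s powr (p - 1) * t \<le> (t / d) powr (p - 1) * t"
    using assms by (intro mult_right_mono) auto
  also have "\<dots> = d powr (1 - p) * (t powr (p - 1) * t)"
    using assms powr_minus_divide[of d "p - 1"] by (simp add: powr_divide)
  also have "\<dots> = d powr (1 - p) * t powr p"
    using powr_pred_mult_self[of t p] assms by simp
  finally show ?thesis using assms by (smt (verit) powr_ge_zero mult_nonneg_nonneg)
qed

lemma Phi_nonneg_eq: "0 \<le> t \<Longrightarrow> Phi p t = t powr (p - 1)"
  using powr_pred_mult_self[of t "p - 1"] by (simp add: Phi_def)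

lemma Phi_minus: "Phi p (- t) = - Phi p t"
  by (simp add: Phi_def)

text \<open>
  The contribution of one edge to the $p$-energy of $u$ against the test function $f^p u^{-e}$.
  Here $a \ge b$ are the values of $u$ and $x, y$ those of the cutoff $f$ at the two ends. Pairing the
  factor $y^p$ with the difference of the powers of $u$, and the factor $a^{-e}$ with
  the difference of the powers of $f$, makes the larger value $a$ appear throughout.
\<close>
lemma caccioppoli_pointwise_ordered:
  fixes p e a b x y :: real
  assumes p: "1 < p" and e: "0 < e" and b: "0 < b" "b \<le> a" and xy: "0 \<le> x" "0 \<le> y"
  defines "K \<equiv> p * 2 powr (p - 1)"
  defines "C \<equiv> K + K * (e / (2 * K)) powr (1 - p)"
  shows "Phi p (a - b) * (x powr p * a powr (- e) - y powr p * b powr (- e))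
    \<le> - (e / 2) * (min x y powr p * (a powr (- 1 - e) * \<bar>a - b\<bar> powr p))
       + C * (\<bar>x - y\<bar> powr p * a powr (p - 1 - e))"
proof -
  have a: "0 < a" using b by simp
  \<comment> \<open>\<open>T\<close> is the flux along the edge, \<open>G\<close> the energy density of the conclusion.\<close>
  define T where "T = (a - b) powr (p - 1)"
  have T: "0 \<le> T" "T * (a - b) = (a - b) powr p" "Phi p (a - b) = T"
    using b powr_pred_mult_self[of "a - b" p] by (auto simp: T_def Phi_nonneg_eq)
  define G where "G = a powr (- 1 - e) * (a - b) powr p"
  have G0: "0 \<le> G" by (simp add: G_def)
  have K: "0 < K" using p by (simp add: K_def)
  have C: "0 \<le> C" using K by (simp add: C_def)
  have "T * y powr p * (e * a powr (- 1 - e) * (a - b)) \<le> T * y powr p * (b powr (- e) - a powr (- e))"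
    using powr_neg_diff_ge[of b a e] b e T by (intro mult_left_mono) auto
  moreover have "T * y powr p * (e * a powr (- 1 - e) * (a - b)) = e * (y powr p * G)"
    unfolding G_def T(2)[symmetric] by (simp add: mult_ac)
  ultimately have main: "T * (x powr p * a powr (- e) - y powr p * b powr (- e))
      \<le> T * a powr (- e) * (x powr p - y powr p) - e * (y powr p * G)"
    by (simp add: algebra_simps)
  have yG: "min x y powr p * G \<le> y powr p * G"
    using xy p G0 by (intro mult_right_mono powr_mono2) auto
  have goal: "T * a powr (- e) * (x powr p - y powr p)
      \<le> (e / 2) * (y powr p * G) + C * (\<bar>x - y\<bar> powr p * a powr (p - 1 - e))"
  proof (cases "x \<le> y")
    case True
    then have "x powr p - y powr p \<le> 0"
      using xy p by (simp add: powr_mono2)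
    then have "T * a powr (- e) * (x powr p - y powr p) \<le> 0"
      using T by (intro mult_nonneg_nonpos) auto
    moreover have "0 \<le> (e / 2) * (y powr p * G)" "0 \<le> C * (\<bar>x - y\<bar> powr p * a powr (p - 1 - e))"
      using e G0 C by auto
    ultimately show ?thesis by linarith
  next
    case False
    define d where "d = x - y"
    have d: "0 < d" "x = y + d" using False by (auto simp: d_def)
    have "x powr (p - 1) \<le> (2 * max y d) powr (p - 1)"
      using d xy p by (intro powr_mono2) auto
    also have "\<dots> = 2 powr (p - 1) * max y d powr (p - 1)"
      using d xy by (simp add: powr_mult)
    also have "\<dots> \<le> 2 powr (p - 1) * (y powr (p - 1) + d powr (p - 1))"
      by (intro mult_left_mono) (auto simp: max_def)
    finally have "x powr (p - 1) * (p * d) \<le> 2 powr (p - 1) * (y powr (p - 1) + d powr (p - 1)) * (p * d)"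
      using p d by (intro mult_right_mono) auto
    also have "\<dots> = K * (y powr (p - 1) * d) + K * d powr p"
      using powr_pred_mult_self[of d p] d by (simp add: K_def algebra_simps)
    finally have "x powr p - y powr p \<le> K * (y powr (p - 1) * d) + K * d powr p"
      using powr_diff_le[of p y x] p xy False d by (simp add: mult_ac)
    then have 1: "T * a powr (- e) * (x powr p - y powr p)
        \<le> T * a powr (- e) * (K * (y powr (p - 1) * d) + K * d powr p)"
      using T by (intro mult_left_mono) auto
    \<comment> \<open>The mixed term is $s^{p-1} t$, where $s^p$ and $t^p$ are the two terms of the conclusion.\<close>
    define s where "s = y * (a - b) * a powr (- (1 + e) / p)"
    define t where "t = d * a powr ((p - 1 - e) / p)"
    have s: "s powr (p - 1) = y powr (p - 1) * T * a powr (- (1 + e) / p * (p - 1))"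
      using xy b a by (simp add: s_def T_def powr_mult powr_powr)
    have exps: "- (1 + e) / p * (p - 1) + (p - 1 - e) / p = - e"
      using p by (simp add: field_simps)
    have "s powr (p - 1) * t = y powr (p - 1) * T * d * (a powr (- (1 + e) / p * (p - 1)) * a powr ((p - 1 - e) / p))"
      unfolding s t_def by (simp add: mult_ac)
    also have "\<dots> = T * a powr (- e) * (y powr (p - 1) * d)"
      unfolding powr_add[symmetric] exps by (simp add: mult_ac)
    finally have st: "s powr (p - 1) * t = T * a powr (- e) * (y powr (p - 1) * d)" .
    have sp: "s powr p = y powr p * G"
      using xy b a p by (simp add: s_def G_def powr_mult powr_powr)
    have tp: "t powr p = d powr p * a powr (p - 1 - e)"
      using d a p by (simp add: t_def powr_mult powr_powr)
    have "0 \<le> s" "0 \<le> t" using xy b d by (auto simp: s_def t_def)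
    then have "K * (s powr (p - 1) * t) \<le>
        K * (e / (2 * K) * s powr p + (e / (2 * K)) powr (1 - p) * t powr p)"
      using weighted_young[of p s t "e / (2 * K)"] p e K by (intro mult_left_mono) auto
    also have "\<dots> = e / 2 * s powr p + K * (e / (2 * K)) powr (1 - p) * t powr p"
      using K by (simp add: field_simps)
    finally have 2: "K * (T * a powr (- e) * (y powr (p - 1) * d))
        \<le> e / 2 * (y powr p * G) + K * (e / (2 * K)) powr (1 - p) * (d powr p * a powr (p - 1 - e))"
      by (simp only: st sp tp)
    have "T \<le> a powr (p - 1)"
      unfolding T_def using b p by (intro powr_mono2) auto
    then have "T * (a powr (- e) * (K * d powr p)) \<le> a powr (p - 1) * (a powr (- e) * (K * d powr p))"
      using K by (intro mult_right_mono) auto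
    also have "\<dots> = K * (d powr p * a powr (p - 1 - e))"
      using a by (simp add: powr_diff powr_minus divide_simps)
    finally have 3: "T * (a powr (- e) * (K * d powr p)) \<le> K * (d powr p * a powr (p - 1 - e))" .
    have "C * (\<bar>x - y\<bar> powr p * a powr (p - 1 - e)) = K * (d powr p * a powr (p - 1 - e))
        + K * (e / (2 * K)) powr (1 - p) * (d powr p * a powr (p - 1 - e))"
      using d by (simp add: C_def algebra_simps)
    with 1 2 3 show ?thesis by (simp add: algebra_simps)
  qed
  have "(e / 2) * (min x y powr p * G) \<le> (e / 2) * (y powr p * G)"
    using yG e by (intro mult_left_mono) auto
  with main goal T(3) b show ?thesis by (simp add: G_def)
qed

text \<open>
  The minimum of the cutoff and the maximum of $u$ at the two ends make the estimate symmetric, so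
  that it can be summed over ordered pairs.
\<close>
lemma caccioppoli_pointwise:
  fixes p e :: real
  assumes p: "1 < p" and e: "0 < e"
  obtains C where "0 < C"
    "\<And>a b x y. \<lbrakk>0 < a; 0 < b; 0 \<le> x; 0 \<le> y\<rbrakk> \<Longrightarrow>
      Phi p (a - b) * (x powr p * a powr (- e) - y powr p * b powr (- e))
      \<le> - (e / 2) * (min x y powr p * (max a b powr (- 1 - e) * \<bar>a - b\<bar> powr p))
         + C * (\<bar>x - y\<bar> powr p * max a b powr (p - 1 - e))"
proof
  define K where "K = p * 2 powr (p - 1)"
  define C where "C = K + K * (e / (2 * K)) powr (1 - p)"
  have "0 < K" using p by (simp add: K_def)
  then show "0 < C" by (simp add: C_def add_pos_nonneg)
  fix a b x y :: real
  assume *: "0 < a" "0 < b" "0 \<le> x" "0 \<le> y"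
  show "Phi p (a - b) * (x powr p * a powr (- e) - y powr p * b powr (- e))
      \<le> - (e / 2) * (min x y powr p * (max a b powr (- 1 - e) * \<bar>a - b\<bar> powr p))
         + C * (\<bar>x - y\<bar> powr p * max a b powr (p - 1 - e))"
  proof (cases "b \<le> a")
    case True
    then show ?thesis
      using caccioppoli_pointwise_ordered[OF p e *(2) True *(3,4)] by (simp add: C_def K_def max_def)
  next
    case False
    then have "a \<le> b" by simp
    have "Phi p (a - b) = - Phi p (b - a)"
      using Phi_minus[of p "b - a"] by simp
    then show ?thesis
      using caccioppoli_pointwise_ordered[OF p e *(1) \<open>a \<le> b\<close> *(4,3)] False
      by (simp add: C_def K_def max_def min.commute abs_minus_commute algebra_simps)
  qed
qed

text \<open>Hoelder's inequality with exponents $1/t$ and $1/(1-t)$, for functions already raised to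
  these powers.\<close>
lemma Holder_inequality_sum:
  fixes f g :: "'i \<Rightarrow> real"
  assumes "0 < t" "t < 1" "\<And>i. i \<in> I \<Longrightarrow> 0 \<le> f i" "\<And>i. i \<in> I \<Longrightarrow> 0 \<le> g i"
  shows "(\<Sum>i\<in>I. f i powr t * g i powr (1 - t)) \<le> (\<Sum>i\<in>I. f i) powr t * (\<Sum>i\<in>I. g i) powr (1 - t)"
proof (cases "(\<Sum>i\<in>I. f i) = 0 \<or> (\<Sum>i\<in>I. g i) = 0 \<or> infinite I")
  case True
  then have "\<forall>i\<in>I. f i powr t * g i powr (1 - t) = 0 \<or> infinite I"
    using assms sum_nonneg_eq_0_iff[of I f] sum_nonneg_eq_0_iff[of I g] by auto
  then have "(\<Sum>i\<in>I. f i powr t * g i powr (1 - t)) = 0"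
    by (cases "finite I") (auto intro: sum.neutral)
  then show ?thesis by simp
next
  case False
  define F where "F = (\<Sum>i\<in>I. f i)"
  define G where "G = (\<Sum>i\<in>I. g i)"
  have FG: "0 < F" "0 < G"
    using False assms by (auto simp: F_def G_def sum_nonneg order_less_le)
  have "f i powr t * g i powr (1 - t) \<le> (F powr t * G powr (1 - t)) * (t * (f i / F) + (1 - t) * (g i / G))"
    if "i \<in> I" for i
  proof (cases "f i = 0 \<or> g i = 0")
    case True
    then show ?thesis using that assms FG by auto
  next
    case False
    then have "0 < f i" "0 < g i"
      using assms(3,4)[OF that] by auto
    then have "(f i / F) powr t * (g i / G) powr (1 - t) \<le> t * (f i / F) + (1 - t) * (g i / G)"
      using FG assms by (intro Youngs_inequality_0) auto
    then have "(F powr t * G powr (1 - t)) * ((f i / F) powr t * (g i / G) powr (1 - t))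
        \<le> (F powr t * G powr (1 - t)) * (t * (f i / F) + (1 - t) * (g i / G))"
      by (intro mult_left_mono) auto
    then show ?thesis
      using FG \<open>0 < f i\<close> \<open>0 < g i\<close> by (simp add: powr_divide)
  qed
  then have "(\<Sum>i\<in>I. f i powr t * g i powr (1 - t))
      \<le> (\<Sum>i\<in>I. (F powr t * G powr (1 - t)) * (t * (f i / F) + (1 - t) * (g i / G)))"
    by (rule sum_mono)
  also have "\<dots> = (F powr t * G powr (1 - t)) * (t * ((\<Sum>i\<in>I. f i) / F) + (1 - t) * ((\<Sum>i\<in>I. g i) / G))"
    by (simp only: sum_distrib_left[symmetric] sum.distrib sum_divide_distrib)
  also have "\<dots> = F powr t * G powr (1 - t)"
    using FG by (simp flip: F_def G_def)
  finally show ?thesis by (simp add: F_def G_def)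
qed

section \<open>Sequences with superlinear growth\<close>

text \<open>
  In terms of $y = J(r) h^\sigma / W(n)$ the growth estimate reads
  $J(r + 4h) h^\sigma / W(n) \ge c\, y^\theta$. If $y > K$, repeating this with $h/2, h/4, \dots$ keeps the
  ratio above $K$ until $h = 1$, where it contradicts $J \le W$. The induction on $m$, with
  $h = 2^m$, runs through these steps backwards.
\<close>
lemma dyadic_mass_bound:
  fixes J W :: "nat \<Rightarrow> real" and c p \<theta> :: real
  assumes c: "0 < c" and \<theta>: "1 < \<theta>"
    and J: "\<And>r. 0 \<le> J r" and W: "\<And>n. 0 < W n" and JW: "\<And>r n. r \<le> n \<Longrightarrow> J r \<le> W n"
    and growth: "\<And>r h n. 0 < h \<Longrightarrow> r + 4 * h \<le> n \<Longrightarrow>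
      J r + c * W n * (J r * real h powr p / W n) powr \<theta> \<le> J (r + 4 * h)"
  defines "\<sigma> \<equiv> p * \<theta> / (\<theta> - 1)"
  obtains K where "1 \<le> K" "\<And>m r n. r + 8 * 2 ^ m \<le> n \<Longrightarrow> J r * (2 ^ m) powr \<sigma> \<le> K * W n"
proof
  \<comment> \<open>Chosen so that $c K^\theta \ge 2^\sigma K$, which closes the induction step.\<close>
  define K where "K = max 1 ((2 powr \<sigma> / c) powr (1 / (\<theta> - 1)))"
  show K1: "1 \<le> K" by (simp add: K_def)
  have "((2 powr \<sigma> / c) powr (1 / (\<theta> - 1))) powr (\<theta> - 1) \<le> K powr (\<theta> - 1)"
    using \<theta> by (intro powr_mono2) (auto simp: K_def)
  then have K: "2 powr \<sigma> / c \<le> K powr (\<theta> - 1)"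
    using \<theta> c by (simp add: powr_powr)
  fix m r n :: nat
  assume "r + 8 * 2 ^ m \<le> n"
  then show "J r * (2 ^ m) powr \<sigma> \<le> K * W n"
  proof (induction m arbitrary: r)
    case 0
    have "J r \<le> W n" using 0 by (intro JW) simp
    also have "W n \<le> K * W n" using K1 W[of n] by simp
    finally show ?case by simp
  next
    case (Suc m)
    define h :: real where "h = 2 ^ Suc m"
    have h: "0 < h" by (simp add: h_def)
    define y where "y = J r * h powr \<sigma> / W n"
    have y: "0 \<le> y" using J W[of n] by (simp add: y_def)
    have IH: "J (r + 4 * 2 ^ Suc m) * (2 ^ m) powr \<sigma> \<le> K * W n"
      using Suc.prems by (intro Suc.IH) simp
    have hm: "(2 ^ m) powr \<sigma> = h powr \<sigma> / 2 powr \<sigma>"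
      by (simp add: h_def powr_mult)
    have "J (r + 4 * 2 ^ Suc m) * h powr \<sigma> \<le> 2 powr \<sigma> * (K * W n)"
      using IH by (simp add: hm field_simps)
    moreover have "c * W n * (J r * h powr p / W n) powr \<theta> * h powr \<sigma> \<le> J (r + 4 * 2 ^ Suc m) * h powr \<sigma>"
      using growth[of "2 ^ Suc m" r n] Suc.prems J[of r] by (intro mult_right_mono) (simp_all add: h_def)
    moreover have "(J r * h powr p / W n) powr \<theta> * h powr \<sigma> = y powr \<theta>"
    proof -
      have "p * \<theta> + \<sigma> = \<sigma> * \<theta>" using \<theta> by (simp add: \<sigma>_def field_simps)
      then show ?thesis
        using h W[of n] J[of r] by (simp add: y_def powr_mult powr_divide powr_powr flip: powr_add)
    qed
    ultimately have "W n * (c * y powr \<theta>) \<le> W n * (2 powr \<sigma> * K)"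
      by (simp add: mult_ac)
    then have "c * y powr \<theta> \<le> 2 powr \<sigma> * K" using W[of n] by simp
    also have "\<dots> \<le> c * (K powr (\<theta> - 1) * K)"
      using K K1 c mult_right_mono[OF K, of "c * K"] by (simp add: mult_ac)
    also have "K powr (\<theta> - 1) * K = K powr \<theta>"
      using powr_pred_mult_self[of K \<theta>] K1 by simp
    finally have "y powr \<theta> \<le> K powr \<theta>" using c by simp
    then have "y \<le> K"
      using powr_less_mono2[of \<theta> K y] K1 \<theta> by (meson not_le order_trans zero_le_one zero_less_one less_trans)
    then show ?case using W[of n] by (simp add: y_def h_def field_simps)
  qed
qed

text \<open>
  Each summand is bounded by a multiple of $j_k^{1-\theta} - j_{k+1}^{1-\theta}$, where
  $j_k = J(16^k)$. If $j_{k+1} < 2 j_k$, this is the growth estimate and convexity;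
  if $j_{k+1} \ge 2 j_k$, the difference is comparable to $j_k^{1-\theta}$ and the a priori bound
  applies.
\<close>
lemma dyadic_volume_sum_bounded:
  fixes J W :: "nat \<Rightarrow> real" and c p \<theta> :: real
  assumes c: "0 < c" and \<theta>: "1 < \<theta>"
    and J: "\<And>r. 0 \<le> J r" and J1: "0 < J 1" and W: "\<And>n. 0 < W n" and JW: "\<And>r n. r \<le> n \<Longrightarrow> J r \<le> W n"
    and J_mono: "\<And>r s. r \<le> s \<Longrightarrow> J r \<le> J s"
    and growth: "\<And>r h n. 0 < h \<Longrightarrow> r + 4 * h \<le> n \<Longrightarrow>
      J r + c * W n * (J r * real h powr p / W n) powr \<theta> \<le> J (r + 4 * h)"
  obtains B where "\<And>m. (\<Sum>k<m. (16 ^ k) powr (p * \<theta>) * W (16 ^ Suc k) powr (1 - \<theta>)) \<le> B"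
proof -
  define \<sigma> where "\<sigma> = p * \<theta> / (\<theta> - 1)"
  obtain K where K: "1 \<le> K"
    and bound: "\<And>m r n. r + 8 * 2 ^ m \<le> n \<Longrightarrow> J r * (2 ^ m) powr \<sigma> \<le> K * W n"
    using dyadic_mass_bound[of c \<theta> J W p, OF c \<theta> J W JW growth] unfolding \<sigma>_def by blast
  define b where "b k = (16 ^ k) powr (p * \<theta>) * W (16 ^ Suc k) powr (1 - \<theta>)" for k
  define j where "j k = J (16 ^ k)" for k
  \<comment> \<open>The two entries of the minimum serve the two cases of the step below.\<close>
  define \<eta> where "\<eta> = min (K powr (1 - \<theta>) * (1 - 2 powr (1 - \<theta>))) ((\<theta> - 1) * 2 powr (- \<theta>) * c)"
  have "2 powr (1 - \<theta>) < 2 powr 0" using \<theta> by (intro powr_less_mono) auto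
  then have \<eta>: "0 < \<eta>" using \<theta> c K by (simp add: \<eta>_def)
  have j_pos: "0 < j k" for k
    using J1 J_mono[of 1 "16 ^ k"] by (simp add: j_def)
  have b_nonneg: "0 \<le> b k" for k by (simp add: b_def)
  have step: "\<eta> * b k \<le> j k powr (1 - \<theta>) - j (Suc k) powr (1 - \<theta>)" for k
  proof -
    define R :: real where "R = 16 ^ k"
    define w where "w = W (16 ^ Suc k)"
    have R: "0 < R" and w: "0 < w" using W by (auto simp: R_def w_def)
    have b: "b k = R powr (p * \<theta>) * w powr (1 - \<theta>)" by (simp add: b_def R_def w_def)
    \<comment> \<open>With step length $R = 16^k$ at radius $R$, the growth estimate and the a priori bound need
      balls of radius $5R$ and $9R$; both lie in the ball of radius $16R$.\<close>
    have le: "(16::nat) ^ k + 4 * 16 ^ k \<le> 16 ^ Suc k" "(16::nat) ^ k + 8 * 2 ^ (4 * k) \<le> 16 ^ Suc k"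
      by (simp_all add: power_mult)
    have "j k + c * w * (j k * R powr p / w) powr \<theta> \<le> J (16 ^ k + 4 * 16 ^ k)"
      using growth[OF _ le(1)] by (simp add: j_def R_def w_def)
    also have "\<dots> \<le> j (Suc k)" unfolding j_def by (rule J_mono[OF le(1)])
    also have "c * w * (j k * R powr p / w) powr \<theta> = c * j k powr \<theta> * b k"
      using w R j_pos[of k] by (simp add: b powr_mult powr_divide powr_powr powr_diff)
    finally have grow: "j k + c * j k powr \<theta> * b k \<le> j (Suc k)" .
    then have inc: "j k \<le> j (Suc k)"
      using c b_nonneg[of k] by (smt (verit) mult_nonneg_nonneg powr_ge_zero)
    have "(2::real) ^ (4 * k) = R" by (simp add: R_def power_mult)
    then have "j k * R powr \<sigma> \<le> K * w"
      using bound[OF le(2)] by (simp add: j_def w_def)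
    then have "j k * R powr \<sigma> / w \<le> K" using w by (simp add: field_simps)
    then have "(j k * R powr \<sigma> / w) powr (\<theta> - 1) \<le> K powr (\<theta> - 1)"
      using \<theta> j_pos[of k] w by (intro powr_mono2) auto
    also have "(j k * R powr \<sigma> / w) powr (\<theta> - 1) = j k powr (\<theta> - 1) * b k"
    proof -
      have "\<sigma> * (\<theta> - 1) = p * \<theta>" using \<theta> by (simp add: \<sigma>_def)
      then show ?thesis
        using w j_pos[of k] R powr_minus_divide[of w "\<theta> - 1"]
        by (simp add: b powr_mult powr_divide powr_powr)
    qed
    finally have apriori: "j k powr (\<theta> - 1) * b k \<le> K powr (\<theta> - 1)" .
    have b_le: "K powr (1 - \<theta>) * b k \<le> j k powr (1 - \<theta>)"
    proof -
      have "K powr (1 - \<theta>) * j k powr (1 - \<theta>) * (j k powr (\<theta> - 1) * b k)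
          \<le> K powr (1 - \<theta>) * j k powr (1 - \<theta>) * K powr (\<theta> - 1)"
        using apriori by (intro mult_left_mono) auto
      moreover have "K powr (1 - \<theta>) * K powr (\<theta> - 1) = 1" "j k powr (1 - \<theta>) * j k powr (\<theta> - 1) = 1"
        using K j_pos[of k] by (simp_all flip: powr_add)
      moreover have "K powr (1 - \<theta>) * j k powr (1 - \<theta>) * (j k powr (\<theta> - 1) * b k)
          = K powr (1 - \<theta>) * b k * (j k powr (1 - \<theta>) * j k powr (\<theta> - 1))"
        "K powr (1 - \<theta>) * j k powr (1 - \<theta>) * K powr (\<theta> - 1)
          = j k powr (1 - \<theta>) * (K powr (1 - \<theta>) * K powr (\<theta> - 1))"
        by (simp_all only: mult_ac)
      ultimately show ?thesis by simp
    qed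
    show ?thesis
    proof (cases "2 * j k \<le> j (Suc k)")
      case True
      have "j (Suc k) powr (1 - \<theta>) \<le> (2 * j k) powr (1 - \<theta>)"
        using True j_pos[of k] \<theta> by (intro powr_mono2') auto
      also have "\<dots> = 2 powr (1 - \<theta>) * j k powr (1 - \<theta>)"
        using j_pos[of k] by (simp add: powr_mult)
      finally have "(1 - 2 powr (1 - \<theta>)) * j k powr (1 - \<theta>) \<le> j k powr (1 - \<theta>) - j (Suc k) powr (1 - \<theta>)"
        by (simp add: algebra_simps)
      moreover have "(1 - 2 powr (1 - \<theta>)) * (K powr (1 - \<theta>) * b k) \<le> (1 - 2 powr (1 - \<theta>)) * j k powr (1 - \<theta>)"
        using b_le \<open>2 powr (1 - \<theta>) < 2 powr 0\<close> by (intro mult_left_mono) auto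
      moreover have "\<eta> * b k \<le> K powr (1 - \<theta>) * (1 - 2 powr (1 - \<theta>)) * b k"
        using b_nonneg[of k] by (intro mult_right_mono) (auto simp: \<eta>_def)
      ultimately show ?thesis by (simp add: mult_ac)
    next
      case False
      have "(\<theta> - 1) * j (Suc k) powr (- \<theta>) * (j (Suc k) - j k) \<le> j k powr (1 - \<theta>) - j (Suc k) powr (1 - \<theta>)"
        using powr_neg_diff_ge[of "j k" "j (Suc k)" "\<theta> - 1"] inc j_pos[of k] \<theta> by simp
      moreover have "(2 powr (- \<theta>) * j k powr (- \<theta>)) * (c * j k powr \<theta> * b k)
          \<le> j (Suc k) powr (- \<theta>) * (j (Suc k) - j k)"
      proof (rule mult_mono)
        have "(2 * j k) powr (- \<theta>) \<le> j (Suc k) powr (- \<theta>)"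
          using False j_pos[of "Suc k"] \<theta> by (intro powr_mono2') auto
        then show "2 powr (- \<theta>) * j k powr (- \<theta>) \<le> j (Suc k) powr (- \<theta>)"
          using j_pos[of k] by (simp add: powr_mult)
      qed (use grow c b_nonneg[of k] in auto)
      moreover have "(2 powr (- \<theta>) * j k powr (- \<theta>)) * (c * j k powr \<theta> * b k) = 2 powr (- \<theta>) * c * b k"
        using j_pos[of k] by (simp add: powr_minus)
      ultimately have "(\<theta> - 1) * (2 powr (- \<theta>) * c * b k) \<le> j k powr (1 - \<theta>) - j (Suc k) powr (1 - \<theta>)"
        using \<theta> by (smt (verit) mult.assoc mult_left_mono)
      moreover have "\<eta> * b k \<le> (\<theta> - 1) * 2 powr (- \<theta>) * c * b k"
        using b_nonneg[of k] by (intro mult_right_mono) (auto simp: \<eta>_def)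
      ultimately show ?thesis by (simp add: mult_ac)
    qed
  qed
  have "(\<Sum>k<m. b k) \<le> j 0 powr (1 - \<theta>) / \<eta>" for m
  proof -
    have "\<eta> * (\<Sum>k<m. b k) \<le> (\<Sum>k<m. j k powr (1 - \<theta>) - j (Suc k) powr (1 - \<theta>))"
      unfolding sum_distrib_left by (intro sum_mono step)
    also have "\<dots> = j 0 powr (1 - \<theta>) - j m powr (1 - \<theta>)"
      by (rule sum_lessThan_telescope')
    also have "\<dots> \<le> j 0 powr (1 - \<theta>)" by simp
    finally show ?thesis using \<eta> by (simp add: field_simps)
  qed
  then show thesis using that unfolding b_def by blast
qed

text \<open>
  Cauchy condensation in base 16. The block from $16^{k+1}$ to $16^{k+2}$ is compared with
  the volume at its lower end, while the power of the radius refers to $16^k$; this accounts for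
  the factor $16^{2a}$.
\<close>
lemma sum_le_condensed_sum:
  fixes W :: "nat \<Rightarrow> real" and a b :: real
  assumes a: "1 \<le> a" and b: "0 \<le> b" and W: "\<And>n. 0 < W n" and mono: "\<And>m n. m \<le> n \<Longrightarrow> W m \<le> W n"
  shows "(\<Sum>i\<in>{16..<16 ^ Suc m}. real i powr (a - 1) / W i powr b)
    \<le> 16 powr (2 * a) * (\<Sum>k<m. (16 ^ k) powr a * W (16 ^ Suc k) powr (- b))"
proof (induction m)
  case (Suc m)
  let ?f = "\<lambda>i. real i powr (a - 1) / W i powr b"
  define R :: real where "R = 16 ^ Suc (Suc m)"
  have R: "0 < R" "R = 16 powr 2 * 16 ^ m" by (simp_all add: R_def)
  have "(\<Sum>i\<in>{16 ^ Suc m..<16 ^ Suc (Suc m)}. ?f i)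
      \<le> (\<Sum>i\<in>{(16::nat) ^ Suc m..<16 ^ Suc (Suc m)}. R powr (a - 1) * W (16 ^ Suc m) powr (- b))"
  proof (rule sum_mono)
    fix i :: nat assume i: "i \<in> {16 ^ Suc m..<16 ^ Suc (Suc m)}"
    have "real i \<le> real (16 ^ Suc (Suc m))"
      using i by (intro of_nat_mono) auto
    then have "real i \<le> R" by (simp add: R_def)
    then have "real i powr (a - 1) \<le> R powr (a - 1)"
      using a by (intro powr_mono2) auto
    moreover have "W i powr (- b) \<le> W (16 ^ Suc m) powr (- b)"
      using i b W mono by (intro powr_mono2') auto
    ultimately have "real i powr (a - 1) * W i powr (- b) \<le> R powr (a - 1) * W (16 ^ Suc m) powr (- b)"
      by (intro mult_mono) auto
    then show "?f i \<le> R powr (a - 1) * W (16 ^ Suc m) powr (- b)"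
      by (simp add: powr_minus divide_inverse)
  qed
  also have "\<dots> = real (16 ^ Suc (Suc m) - 16 ^ Suc m) * (R powr (a - 1) * W (16 ^ Suc m) powr (- b))"
    by simp
  also have "\<dots> \<le> R * (R powr (a - 1) * W (16 ^ Suc m) powr (- b))"
    by (intro mult_right_mono) (auto simp: R_def)
  also have "\<dots> = R powr a * W (16 ^ Suc m) powr (- b)"
    using powr_pred_mult_self[of R a] R by (simp add: mult_ac)
  also have "R powr a = 16 powr (2 * a) * (16 ^ m) powr a"
    unfolding R(2) powr_powr[symmetric] by (rule powr_mult)
  finally have "(\<Sum>i\<in>{16 ^ Suc m..<16 ^ Suc (Suc m)}. ?f i)
      \<le> 16 powr (2 * a) * ((16 ^ m) powr a * W (16 ^ Suc m) powr (- b))"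
    by (simp add: mult_ac)
  moreover have "(\<Sum>i\<in>{16..<16 ^ Suc (Suc m)}. ?f i)
      = (\<Sum>i\<in>{16..<16 ^ Suc m}. ?f i) + (\<Sum>i\<in>{16 ^ Suc m..<16 ^ Suc (Suc m)}. ?f i)"
    by (rule sum.atLeastLessThan_concat[symmetric]) auto
  ultimately show ?case using Suc.IH by (simp add: algebra_simps)
qed simp

section \<open>Weighted graphs with a root\<close>

text \<open>An infinite, connected, locally finite weighted graph with a distinguished vertex \<open>z\<close>, from
  which distances are measured.\<close>
locale locally_finite_weighted_graph = weighted_graph V E w
  for V :: "'a set" and E :: "'a set set" and w :: "'a \<Rightarrow> 'a \<Rightarrow> real" +
  fixes z :: 'a
  assumes infinite_V: "infinite V"
    and connected: "connected_graph V E"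
    and locally_finite: "locally_finite_graph V E"
    and z_in_V: "z \<in> V"
begin

abbreviation "\<mu> \<equiv> vertex_measure E w"
abbreviation "\<rho> \<equiv> graph_dist E z"

text \<open>The measure of the closed ball of radius \<open>n\<close> around \<open>z\<close>.\<close>
definition volume :: "nat \<Rightarrow> real" where
  "volume n = set_measure E w (graph_ball V E z n)"

text \<open>The vertices at distance between \<open>r\<close> and \<open>s\<close> from \<open>z\<close>, both bounds included.\<close>
definition annulus :: "nat \<Rightarrow> nat \<Rightarrow> 'a set" where
  "annulus r s = {x \<in> V. r \<le> \<rho> x \<and> \<rho> x \<le> s}"

text \<open>The edges with both ends in \<open>A\<close>, as ordered pairs: an edge that is not a loop occurs twice.\<close>
definition inner_edges :: "'a set \<Rightarrow> ('a \<times> 'a) set" where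
  "inner_edges A = (SIGMA x:A. {y \<in> A. {x, y} \<in> E})"

lemma edge_in_V:
  assumes "{x, y} \<in> E"
  shows "x \<in> V" "y \<in> V"
  using edge_ends[OF assms] by (auto simp: doubleton_eq_iff)

lemma finite_neighbours: "x \<in> V \<Longrightarrow> finite (neighbours E x)"
  using locally_finite by (simp add: locally_finite_graph_def)

lemma weight_nonneg: "{x, y} \<in> E \<Longrightarrow> 0 \<le> w x y"
  using weight_pos by (simp add: less_imp_le)

lemma weight_swap: "{x, y} \<in> E \<Longrightarrow> w y x = w x y"
  by (rule weight_sym[symmetric])

lemma vertex_measure_pos:
  assumes x: "x \<in> V"
  shows "0 < \<mu> x"
proof -
  obtain y where "y \<in> V" "y \<noteq> x"
    using infinite_V by (metis finite.emptyI finite_insert finite_subset insertCI subsetI)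
  then have "(x, y) \<in> (adjacency E)\<^sup>*"
    using x connected by (simp add: connected_graph_def)
  then obtain a where "(x, a) \<in> adjacency E"
    using \<open>y \<noteq> x\<close> by (metis converse_rtranclE)
  then have "a \<in> neighbours E x" by (simp add: adjacency_def neighbours_def)
  then show ?thesis
    unfolding vertex_measure_def
    using finite_neighbours[OF x] weight_pos
    by (intro sum_pos) (auto simp: neighbours_def)
qed

lemma vertex_measure_nonneg: "x \<in> V \<Longrightarrow> 0 \<le> \<mu> x"
  using vertex_measure_pos by (simp add: less_imp_le)

lemma dist_attained:
  assumes "x \<in> V"
  shows "(z, x) \<in> adjacency E ^^ \<rho> x"
proof -
  have "(z, x) \<in> (adjacency E)\<^sup>*"
    using assms z_in_V connected by (simp add: connected_graph_def)
  then obtain n where "(z, x) \<in> adjacency E ^^ n"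
    by (auto simp: rtrancl_power)
  then show ?thesis unfolding graph_dist_def by (rule LeastI)
qed

lemma dist_self: "\<rho> z = 0"
  unfolding graph_dist_def by (rule Least_eq_0) simp

lemma dist_edge_le:
  assumes "{x, y} \<in> E"
  shows "\<rho> y \<le> \<rho> x + 1"
proof -
  have "(z, y) \<in> adjacency E ^^ Suc (\<rho> x)"
    using dist_attained[OF edge_in_V(1)[OF assms]] assms by (auto simp: adjacency_def)
  then show ?thesis
    using Least_le[of "\<lambda>n. (z, y) \<in> adjacency E ^^ n" "Suc (\<rho> x)"] by (simp add: graph_dist_def)
qed

lemma dist_edge:
  assumes "{x, y} \<in> E"
  shows "\<rho> y \<le> \<rho> x + 1" "\<rho> x \<le> \<rho> y + 1"
  using assms dist_edge_le[of x y] dist_edge_le[of y x] by (simp_all add: insert_commute)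

lemma finite_relpow_image: "finite {x. (z, x) \<in> adjacency E ^^ n}"
proof (induction n)
  case (Suc n)
  have "finite (neighbours E x)" for x
  proof (cases "x \<in> V")
    case False
    then have "neighbours E x = {}" using edge_in_V by (auto simp: neighbours_def)
    then show ?thesis by simp
  qed (rule finite_neighbours)
  moreover have "{x. (z, x) \<in> adjacency E ^^ Suc n}
      = (\<Union>y\<in>{x. (z, x) \<in> adjacency E ^^ n}. neighbours E y)"
    by (auto simp: adjacency_def neighbours_def)
  ultimately show ?case using Suc by simp
qed simp

lemma finite_dist_le: "finite {x \<in> V. \<rho> x \<le> n}"
proof (rule finite_subset)
  show "{x \<in> V. \<rho> x \<le> n} \<subseteq> (\<Union>k\<le>n. {x. (z, x) \<in> adjacency E ^^ k})"
    using dist_attained by auto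
qed (simp add: finite_relpow_image)

lemma finite_dist_subset: "A \<subseteq> {x \<in> V. \<rho> x \<le> n} \<Longrightarrow> finite A"
  using finite_dist_le finite_subset by blast

lemma finite_dist_less: "finite {x \<in> V. \<rho> x < n}"
  by (rule finite_dist_subset[of _ n]) auto

lemma finite_annulus: "finite (annulus r s)"
  by (rule finite_dist_subset[of _ s]) (auto simp: annulus_def)

lemma volume_eq: "volume n = (\<Sum>x\<in>{x \<in> V. \<rho> x \<le> n}. \<mu> x)"
  by (simp add: volume_def set_measure_def graph_ball_def)

lemma sum_measure_le_volume:
  assumes "A \<subseteq> {x \<in> V. \<rho> x \<le> n}"
  shows "(\<Sum>x\<in>A. \<mu> x) \<le> volume n"
  unfolding volume_eq using assms finite_dist_le vertex_measure_nonneg by (intro sum_mono2) auto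

lemma volume_pos: "0 < volume n"
proof -
  have "(\<Sum>x\<in>{z}. \<mu> x) \<le> volume n"
    using z_in_V by (intro sum_measure_le_volume) (auto simp: dist_self)
  then show ?thesis using vertex_measure_pos[OF z_in_V] by simp
qed

lemma volume_mono: "m \<le> n \<Longrightarrow> volume m \<le> volume n"
  unfolding volume_eq[of m] by (rule sum_measure_le_volume) auto

lemma inner_edges_iff: "(x, y) \<in> inner_edges A \<longleftrightarrow> x \<in> A \<and> y \<in> A \<and> {x, y} \<in> E"
  by (auto simp: inner_edges_def)

lemma finite_inner_edges: "finite A \<Longrightarrow> finite (inner_edges A)"
  by (auto simp: inner_edges_def)

lemma sum_inner_edges_swap:
  "(\<Sum>(x, y)\<in>inner_edges A. f x y) = (\<Sum>(x, y)\<in>inner_edges A. f y x)"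
  by (rule sum.reindex_bij_witness[of _ prod.swap prod.swap])
    (auto simp: inner_edges_iff insert_commute)

lemma sum_inner_edges_max_le:
  fixes g :: "'a \<Rightarrow> real"
  assumes "finite A" "A \<subseteq> V" and g: "\<And>x. x \<in> A \<Longrightarrow> 0 < g x"
  shows "(\<Sum>(x, y)\<in>inner_edges A. w x y * max (g x) (g y) powr s) \<le> 2 * (\<Sum>x\<in>A. \<mu> x * g x powr s)"
proof -
  have one: "(\<Sum>(x, y)\<in>inner_edges A. w x y * g x powr s) \<le> (\<Sum>x\<in>A. \<mu> x * g x powr s)"
  proof -
    have "(\<Sum>(x, y)\<in>inner_edges A. w x y * g x powr s) = (\<Sum>x\<in>A. \<Sum>y\<in>{y \<in> A. {x, y} \<in> E}. w x y * g x powr s)"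
      unfolding inner_edges_def using assms by (subst sum.Sigma) auto
    also have "\<dots> \<le> (\<Sum>x\<in>A. \<mu> x * g x powr s)"
    proof (rule sum_mono)
      fix x assume "x \<in> A"
      then have "(\<Sum>y\<in>{y \<in> A. {x, y} \<in> E}. w x y) \<le> \<mu> x"
        unfolding vertex_measure_def neighbours_def
        using assms finite_neighbours[of x] weight_nonneg
        by (intro sum_mono2) (auto simp: neighbours_def)
      then show "(\<Sum>y\<in>{y \<in> A. {x, y} \<in> E}. w x y * g x powr s) \<le> \<mu> x * g x powr s"
        by (simp flip: sum_distrib_right add: mult_right_mono)
    qed
    finally show ?thesis .
  qed
  have "(\<Sum>(x, y)\<in>inner_edges A. w x y * g y powr s) = (\<Sum>(x, y)\<in>inner_edges A. w y x * g x powr s)"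
    by (rule sum_inner_edges_swap)
  also have "\<dots> = (\<Sum>(x, y)\<in>inner_edges A. w x y * g x powr s)"
    by (intro sum.cong) (auto simp: inner_edges_iff intro!: weight_swap)
  finally have two: "(\<Sum>(x, y)\<in>inner_edges A. w x y * g y powr s) = (\<Sum>(x, y)\<in>inner_edges A. w x y * g x powr s)" .
  have "(\<Sum>(x, y)\<in>inner_edges A. w x y * max (g x) (g y) powr s)
      \<le> (\<Sum>(x, y)\<in>inner_edges A. w x y * g x powr s + w x y * g y powr s)"
    by (intro sum_mono) (auto simp: inner_edges_iff max_def weight_nonneg)
  also have "\<dots> = (\<Sum>(x, y)\<in>inner_edges A. w x y * g x powr s) + (\<Sum>(x, y)\<in>inner_edges A. w x y * g y powr s)"
    by (simp add: sum.distrib case_prod_unfold)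
  finally show ?thesis using one two by simp
qed

end

section \<open>Positive supersolutions\<close>

text \<open>A strictly positive function \<open>u\<close> satisfying the differential inequality on the whole graph.\<close>
locale superlinear_supersolution = locally_finite_weighted_graph V E w z
  for V :: "'a set" and E :: "'a set set" and w :: "'a \<Rightarrow> 'a \<Rightarrow> real" and z :: 'a +
  fixes p q :: real and u :: "'a \<Rightarrow> real"
  assumes p_gt_1: "1 < p" and q_gt: "p - 1 < q"
    and u_pos: "x \<in> V \<Longrightarrow> 0 < u x"
    and supersolution: "x \<in> V \<Longrightarrow> u x powr q \<le> - p_laplacian E w p u x"
begin

text \<open>The integral of $u^q$ over the open ball of radius \<open>r\<close>. With open balls, the annulus that starts
  at distance \<open>r\<close> is disjoint from the ball of radius \<open>r\<close>.\<close>
definition mass :: "nat \<Rightarrow> real" where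
  "mass r = (\<Sum>x\<in>{x \<in> V. \<rho> x < r}. \<mu> x * u x powr q)"

lemma supersolution_sum:
  assumes "x \<in> V"
  shows "\<mu> x * u x powr q \<le> (\<Sum>y\<in>neighbours E x. w x y * Phi p (u x - u y))"
proof -
  have "\<mu> x * u x powr q \<le> \<mu> x * - p_laplacian E w p u x"
    using supersolution[OF assms] vertex_measure_nonneg[OF assms] by (rule mult_left_mono)
  also have "\<dots> = - (\<Sum>y\<in>neighbours E x. w x y * Phi p (u y - u x))"
    using vertex_measure_pos[OF assms] by (simp add: p_laplacian_def)
  also have "\<dots> = (\<Sum>y\<in>neighbours E x. w x y * Phi p (u x - u y))"
    unfolding sum_negf[symmetric]
  proof (rule sum.cong)
    fix y
    show "- (w x y * Phi p (u y - u x)) = w x y * Phi p (u x - u y)"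
      using Phi_minus[of p "u x - u y"] by simp
  qed simp
  finally show ?thesis .
qed

text \<open>Since \<open>u\<close> is positive, $-\Delta_p u(x) \le u(x)^{p-1}$, so that $u^q \le u^{p-1}$ with
  $q > p - 1$.\<close>
lemma le_one:
  assumes x: "x \<in> V"
  shows "u x \<le> 1"
proof (rule ccontr)
  assume "\<not> u x \<le> 1"
  have "\<mu> x * u x powr q \<le> (\<Sum>y\<in>neighbours E x. w x y * Phi p (u x - u y))"
    by (rule supersolution_sum[OF x])
  also have "\<dots> \<le> (\<Sum>y\<in>neighbours E x. w x y * u x powr (p - 1))"
  proof (intro sum_mono mult_left_mono)
    fix y assume "y \<in> neighbours E x"
    then have xy: "{x, y} \<in> E" by (simp add: neighbours_def)
    then show "0 \<le> w x y" by (rule weight_nonneg)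
    have y: "0 < u y" using u_pos edge_in_V[OF xy] by blast
    show "Phi p (u x - u y) \<le> u x powr (p - 1)"
    proof (cases "u y \<le> u x")
      case True
      then show ?thesis using y p_gt_1 by (simp add: Phi_nonneg_eq powr_mono2)
    next
      case False
      then have "Phi p (u x - u y) \<le> 0" by (simp add: Phi_def mult_nonneg_nonpos)
      then show ?thesis by (rule order_trans) simp
    qed
  qed
  also have "\<dots> = \<mu> x * u x powr (p - 1)"
    by (simp add: vertex_measure_def sum_distrib_right)
  finally have "u x powr q \<le> u x powr (p - 1)"
    using vertex_measure_pos[OF x] by simp
  with \<open>\<not> u x \<le> 1\<close> q_gt show False by simp
qed

text \<open>
  The weak form of the inequality: testing with a nonnegative function \<open>f\<close> on a finite set \<open>N\<close> that
  contains the neighbours of the support of \<open>f\<close>. The factor 2 stems from summing over ordered pairs.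
\<close>
lemma green_inequality:
  assumes N: "finite N" "N \<subseteq> V" and f: "\<And>x. x \<in> N \<Longrightarrow> 0 \<le> f x"
    and supp: "\<And>x. x \<in> N \<Longrightarrow> f x \<noteq> 0 \<Longrightarrow> neighbours E x \<subseteq> N"
  shows "2 * (\<Sum>x\<in>N. f x * (\<mu> x * u x powr q))
    \<le> (\<Sum>(x, y)\<in>inner_edges N. w x y * (Phi p (u x - u y) * (f x - f y)))"
proof -
  let ?g = "\<lambda>x y. f x * (w x y * Phi p (u x - u y))"
  have "(\<Sum>x\<in>N. f x * (\<mu> x * u x powr q)) \<le> (\<Sum>x\<in>N. \<Sum>y\<in>{y \<in> N. {x, y} \<in> E}. ?g x y)"
  proof (rule sum_mono)
    fix x assume x: "x \<in> N"
    show "f x * (\<mu> x * u x powr q) \<le> (\<Sum>y\<in>{y \<in> N. {x, y} \<in> E}. ?g x y)"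
    proof (cases "f x = 0")
      case False
      then have "{y \<in> N. {x, y} \<in> E} = neighbours E x"
        using supp[OF x] by (auto simp: neighbours_def)
      then show ?thesis
        using mult_left_mono[OF supersolution_sum f[OF x]] x N by (auto simp: sum_distrib_left)
    qed simp
  qed
  also have "\<dots> = (\<Sum>(x, y)\<in>inner_edges N. ?g x y)"
    unfolding inner_edges_def using N by (subst sum.Sigma) auto
  finally have 1: "(\<Sum>x\<in>N. f x * (\<mu> x * u x powr q)) \<le> (\<Sum>(x, y)\<in>inner_edges N. ?g x y)" .
  have "(\<Sum>(x, y)\<in>inner_edges N. ?g x y) = (\<Sum>(x, y)\<in>inner_edges N. ?g y x)"
    by (rule sum_inner_edges_swap)
  also have "\<dots> = (\<Sum>(x, y)\<in>inner_edges N. - (f y * (w x y * Phi p (u x - u y))))"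
  proof (intro sum.cong refl, clarify)
    fix x y assume "(x, y) \<in> inner_edges N"
    then have "w y x = w x y" by (simp add: inner_edges_iff weight_swap)
    then show "?g y x = - (f y * (w x y * Phi p (u x - u y)))"
      using Phi_minus[of p "u x - u y"] by simp
  qed
  finally have "2 * (\<Sum>(x, y)\<in>inner_edges N. ?g x y)
      = (\<Sum>(x, y)\<in>inner_edges N. ?g x y) + (\<Sum>(x, y)\<in>inner_edges N. - (f y * (w x y * Phi p (u x - u y))))"
    by simp
  also have "\<dots> = (\<Sum>(x, y)\<in>inner_edges N. w x y * (Phi p (u x - u y) * (f x - f y)))"
    unfolding sum.distrib[symmetric] by (intro sum.cong) (auto simp: algebra_simps)
  finally show ?thesis using 1 by simp
qed

lemma mass_nonneg: "0 \<le> mass r"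
  unfolding mass_def by (intro sum_nonneg) (auto simp: vertex_measure_nonneg)

lemma mass_pos: assumes "0 < r" shows "0 < mass r"
proof -
  have "z \<in> {x \<in> V. \<rho> x < r}"
    using assms z_in_V by (simp add: dist_self)
  moreover have "0 < \<mu> z * u z powr q"
    using vertex_measure_pos u_pos[OF z_in_V] z_in_V by simp
  ultimately show ?thesis
    unfolding mass_def using finite_dist_less
    by (intro sum_pos2[of _ z]) (auto simp: vertex_measure_nonneg)
qed

lemma mass_mono: "r \<le> s \<Longrightarrow> mass r \<le> mass s"
  unfolding mass_def using finite_dist_less vertex_measure_nonneg by (intro sum_mono2) auto

lemma mass_le_volume:
  assumes "r \<le> n"
  shows "mass r \<le> volume n"
proof -
  have "mass r \<le> (\<Sum>x\<in>{x \<in> V. \<rho> x < r}. \<mu> x)"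
    unfolding mass_def
  proof (intro sum_mono mult_left_le)
    fix x assume "x \<in> {x \<in> V. \<rho> x < r}"
    then have x: "x \<in> V" by simp
    show "0 \<le> \<mu> x" using x by (rule vertex_measure_nonneg)
    show "u x powr q \<le> 1"
      using le_one[OF x] u_pos[OF x] p_gt_1 q_gt powr_mono2[of q "u x" 1] by simp
  qed
  also have "\<dots> \<le> volume n"
    using assms by (intro sum_measure_le_volume) auto
  finally show ?thesis .
qed

end

section \<open>Estimates on annuli\<close>

lemma cutoff_lipschitz:
  fixes s t h :: real
  assumes "0 < h" "\<bar>s - t\<bar> \<le> 1"
  shows "\<bar>min 1 (max 0 (s / h)) - min 1 (max 0 (t / h))\<bar> \<le> 1 / h"
proof -
  have "\<bar>min 1 (max 0 a) - min 1 (max 0 b)\<bar> \<le> \<bar>a - b\<bar>" for a b :: real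
    by (auto simp: min_def max_def abs_if)
  also have "\<bar>s / h - t / h\<bar> \<le> 1 / h"
    using assms by (simp add: field_simps flip: diff_divide_distrib)
  finally show ?thesis .
qed

context superlinear_supersolution
begin

text \<open>
  The cutoff equals 1 up to distance $r + h$, vanishes from distance $r + 2h$ on and changes by at
  most $1/h$ along an edge. Only edges inside the annulus contribute to the right-hand side of the
  weak inequality.
\<close>
lemma flux_through_annulus:
  assumes h: "0 < h"
  shows "2 * real h * mass r
    \<le> (\<Sum>(x, y)\<in>inner_edges (annulus (r + h) (r + 2 * h)). w x y * \<bar>u x - u y\<bar> powr (p - 1))"
proof -
  define f where "f x = min 1 (max 0 ((real (r + 2 * h) - real (\<rho> x)) / real h))" for x
  define N where "N = {x \<in> V. \<rho> x \<le> r + 2 * h}"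
  define A where "A = annulus (r + h) (r + 2 * h)"
  have N: "finite N" "N \<subseteq> V" unfolding N_def by (rule finite_dist_le) auto
  have AN: "inner_edges A \<subseteq> inner_edges N"
    by (auto simp: inner_edges_def A_def N_def annulus_def)
  have f1: "f x = 1" if "\<rho> x \<le> r + h" for x
    using that h by (simp add: f_def field_simps)
  have f0: "f x = 0" if "r + 2 * h \<le> \<rho> x" for x
  proof -
    have "(real (r + 2 * h) - real (\<rho> x)) / real h \<le> 0"
      using that h by (intro divide_nonpos_pos) auto
    then show ?thesis by (simp add: f_def)
  qed
  have f_nonneg: "0 \<le> f x" for x by (simp add: f_def)
  have lip: "\<bar>f x - f y\<bar> \<le> 1 / real h" if "{x, y} \<in> E" for x y
    unfolding f_def using h dist_edge[OF that] by (intro cutoff_lipschitz) auto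
  have "mass r = (\<Sum>x\<in>{x \<in> V. \<rho> x < r}. f x * (\<mu> x * u x powr q))"
    unfolding mass_def using f1 by (intro sum.cong) auto
  also have "\<dots> \<le> (\<Sum>x\<in>N. f x * (\<mu> x * u x powr q))"
    using N f_nonneg vertex_measure_nonneg by (intro sum_mono2) (auto simp: N_def)
  finally have "2 * mass r \<le> 2 * (\<Sum>x\<in>N. f x * (\<mu> x * u x powr q))" by simp
  also have "\<dots> \<le> (\<Sum>(x, y)\<in>inner_edges N. w x y * (Phi p (u x - u y) * (f x - f y)))"
  proof (rule green_inequality[OF N])
    fix x assume "x \<in> N" "f x \<noteq> 0"
    then have "\<rho> x < r + 2 * h" using f0[of x] by (meson not_le)
    then show "neighbours E x \<subseteq> N"
      unfolding N_def neighbours_def using dist_edge(1) edge_in_V(2) by fastforce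
  qed (rule f_nonneg)
  also have "\<dots> = (\<Sum>(x, y)\<in>inner_edges A. w x y * (Phi p (u x - u y) * (f x - f y)))"
  proof (rule sum.mono_neutral_right[OF finite_inner_edges[OF N(1)] AN], clarify)
    fix x y assume "(x, y) \<in> inner_edges N" and nA: "(x, y) \<notin> inner_edges A"
    then have xy: "{x, y} \<in> E" "x \<in> N" "y \<in> N" by (auto simp: inner_edges_iff)
    then have "\<rho> x < r + h \<or> \<rho> y < r + h"
      using nA by (auto simp: inner_edges_iff A_def N_def annulus_def)
    then have "\<rho> x \<le> r + h" "\<rho> y \<le> r + h" using dist_edge[OF xy(1)] by auto
    then show "w x y * (Phi p (u x - u y) * (f x - f y)) = 0" by (simp add: f1)
  qed
  also have "\<dots> \<le> (\<Sum>(x, y)\<in>inner_edges A. w x y * \<bar>u x - u y\<bar> powr (p - 1) * (1 / real h))"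
  proof (rule sum_mono, clarify)
    fix x y assume "(x, y) \<in> inner_edges A"
    then have xy: "{x, y} \<in> E" by (simp add: inner_edges_iff)
    have "Phi p (u x - u y) * (f x - f y) \<le> \<bar>Phi p (u x - u y)\<bar> * \<bar>f x - f y\<bar>"
      by (metis abs_ge_self abs_mult)
    also have "\<bar>Phi p (u x - u y)\<bar> = \<bar>u x - u y\<bar> powr (p - 1)"
      using powr_pred_mult_self[of "\<bar>u x - u y\<bar>" "p - 1"] by (simp add: Phi_def abs_mult)
    also have "\<bar>u x - u y\<bar> powr (p - 1) * \<bar>f x - f y\<bar> \<le> \<bar>u x - u y\<bar> powr (p - 1) * (1 / real h)"
      by (intro mult_left_mono lip xy) simp
    finally have "w x y * (Phi p (u x - u y) * (f x - f y)) \<le> w x y * (\<bar>u x - u y\<bar> powr (p - 1) * (1 / real h))"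
      by (rule mult_left_mono) (rule weight_nonneg[OF xy])
    then show "w x y * (Phi p (u x - u y) * (f x - f y)) \<le> w x y * \<bar>u x - u y\<bar> powr (p - 1) * (1 / real h)"
      by (simp add: mult.assoc)
  qed
  also have "\<dots> = (\<Sum>(x, y)\<in>inner_edges A. w x y * \<bar>u x - u y\<bar> powr (p - 1)) / real h"
    by (simp add: case_prod_unfold sum_divide_distrib)
  finally show ?thesis using h by (simp add: A_def field_simps)
qed

text \<open>
  The Caccioppoli inequality, from the test function $f^p u^{-e}$. The cutoff \<open>f\<close> rises from 0 to 1
  between the distances $r$ and $r + h$ and falls back to 0 between $r + 2h$ and $r + 3h$. The
  constant depends on neither \<open>r\<close> nor \<open>h\<close>.
\<close>
lemma caccioppoli_annulus:
  assumes e: "0 < e"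
  obtains C where "0 < C"
    "\<And>r h. 0 < h \<Longrightarrow>
      (\<Sum>(x, y)\<in>inner_edges (annulus (r + h) (r + 2 * h)).
         w x y * (max (u x) (u y) powr (- 1 - e) * \<bar>u x - u y\<bar> powr p))
      \<le> C * real h powr (- p) * (\<Sum>x\<in>annulus r (r + 3 * h). \<mu> x * u x powr (p - 1 - e))"
proof -
  obtain C where C: "0 < C" and
    pointwise: "\<And>a b x y. \<lbrakk>0 < a; 0 < b; 0 \<le> x; 0 \<le> y\<rbrakk> \<Longrightarrow>
      Phi p (a - b) * (x powr p * a powr (- e) - y powr p * b powr (- e))
      \<le> - (e / 2) * (min x y powr p * (max a b powr (- 1 - e) * \<bar>a - b\<bar> powr p))
         + C * (\<bar>x - y\<bar> powr p * max a b powr (p - 1 - e))"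
    using caccioppoli_pointwise[OF p_gt_1 e] by blast
  show thesis
  proof
    show "0 < 4 * C / e" using C e by simp
    fix r h :: nat
    assume h: "0 < h"
    define t where "t x = min (real (\<rho> x) - real r) (real (r + 3 * h) - real (\<rho> x))" for x
    define f where "f x = min 1 (max 0 (t x / real h))" for x
    define N where "N = {x \<in> V. \<rho> x \<le> r + 3 * h}"
    define A where "A = annulus r (r + 3 * h)"
    define B where "B = annulus (r + h) (r + 2 * h)"
    define g where "g x y = max (u x) (u y) powr (- 1 - e) * \<bar>u x - u y\<bar> powr p" for x y
    define m where "m x y = max (u x) (u y) powr (p - 1 - e)" for x y
    have N: "finite N" "N \<subseteq> V" unfolding N_def by (rule finite_dist_le) auto
    have AN: "inner_edges A \<subseteq> inner_edges N" and BN: "inner_edges B \<subseteq> inner_edges N"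
      by (auto simp: inner_edges_def A_def B_def N_def annulus_def)
    have f1: "f x = 1" if "x \<in> B" for x
      using that h by (auto simp: f_def t_def B_def annulus_def min_def field_simps)
    have f0: "f x = 0" if "\<rho> x \<le> r \<or> r + 3 * h \<le> \<rho> x" for x
    proof -
      have "t x \<le> 0" using that by (auto simp: t_def min_def)
      then have "t x / real h \<le> 0" using h by (intro divide_nonpos_pos) auto
      then show ?thesis by (simp add: f_def)
    qed
    have f_nonneg: "0 \<le> f x" for x by (simp add: f_def)
    have lip: "\<bar>f x - f y\<bar> \<le> 1 / real h" if "{x, y} \<in> E" for x y
      unfolding f_def using h dist_edge[OF that] by (intro cutoff_lipschitz) (auto simp: t_def min_def)
    have g_nonneg: "0 \<le> g x y" for x y by (simp add: g_def)
    have "0 \<le> 2 * (\<Sum>x\<in>N. (f x powr p * u x powr (- e)) * (\<mu> x * u x powr q))"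
      using N vertex_measure_nonneg by (intro mult_nonneg_nonneg sum_nonneg) auto
    also have "\<dots> \<le> (\<Sum>(x, y)\<in>inner_edges N.
        w x y * (Phi p (u x - u y) * (f x powr p * u x powr (- e) - f y powr p * u y powr (- e))))"
    proof (rule green_inequality[OF N])
      fix x assume "x \<in> N" "f x powr p * u x powr (- e) \<noteq> 0"
      then have "\<rho> x < r + 3 * h" using f0[of x] by (cases "r + 3 * h \<le> \<rho> x") auto
      then show "neighbours E x \<subseteq> N"
        unfolding N_def neighbours_def using dist_edge(1) edge_in_V(2) by fastforce
    qed simp
    also have "\<dots> \<le> (\<Sum>(x, y)\<in>inner_edges N. - (e / 2) * (w x y * (min (f x) (f y) powr p * g x y))
        + C * (w x y * (\<bar>f x - f y\<bar> powr p * m x y)))"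
    proof (rule sum_mono, clarify)
      fix x y assume "(x, y) \<in> inner_edges N"
      then have xy: "{x, y} \<in> E" by (simp add: inner_edges_iff)
      show "w x y * (Phi p (u x - u y) * (f x powr p * u x powr (- e) - f y powr p * u y powr (- e)))
        \<le> - (e / 2) * (w x y * (min (f x) (f y) powr p * g x y)) + C * (w x y * (\<bar>f x - f y\<bar> powr p * m x y))"
        using mult_left_mono[OF pointwise[OF u_pos[OF edge_in_V(1)[OF xy]] u_pos[OF edge_in_V(2)[OF xy]]
              f_nonneg[of x] f_nonneg[of y]] weight_nonneg[OF xy]]
        by (simp add: g_def m_def algebra_simps)
    qed
    also have "\<dots> = - (e / 2) * (\<Sum>(x, y)\<in>inner_edges N. w x y * (min (f x) (f y) powr p * g x y))
        + C * (\<Sum>(x, y)\<in>inner_edges N. w x y * (\<bar>f x - f y\<bar> powr p * m x y))"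
      by (simp only: case_prod_unfold sum.distrib sum_distrib_left)
    finally have 1: "(e / 2) * (\<Sum>(x, y)\<in>inner_edges N. w x y * (min (f x) (f y) powr p * g x y))
        \<le> C * (\<Sum>(x, y)\<in>inner_edges N. w x y * (\<bar>f x - f y\<bar> powr p * m x y))"
      by simp
    have "(\<Sum>(x, y)\<in>inner_edges B. w x y * g x y)
        = (\<Sum>(x, y)\<in>inner_edges B. w x y * (min (f x) (f y) powr p * g x y))"
      by (intro sum.cong) (auto simp: inner_edges_iff f1)
    also have "\<dots> \<le> (\<Sum>(x, y)\<in>inner_edges N. w x y * (min (f x) (f y) powr p * g x y))"
      using BN finite_inner_edges[OF N(1)] weight_nonneg g_nonneg
      by (intro sum_mono2) (auto simp: inner_edges_iff)
    finally have 2: "(e / 2) * (\<Sum>(x, y)\<in>inner_edges B. w x y * g x y)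
        \<le> (e / 2) * (\<Sum>(x, y)\<in>inner_edges N. w x y * (min (f x) (f y) powr p * g x y))"
      using e by (intro mult_left_mono) auto
    have "(\<Sum>(x, y)\<in>inner_edges N. w x y * (\<bar>f x - f y\<bar> powr p * m x y))
        = (\<Sum>(x, y)\<in>inner_edges A. w x y * (\<bar>f x - f y\<bar> powr p * m x y))"
    proof (rule sum.mono_neutral_right[OF finite_inner_edges[OF N(1)] AN], clarify)
      fix x y assume "(x, y) \<in> inner_edges N" and nA: "(x, y) \<notin> inner_edges A"
      then have xy: "{x, y} \<in> E" "x \<in> N" "y \<in> N" by (auto simp: inner_edges_iff)
      then have "\<rho> x < r \<or> \<rho> y < r"
        using nA by (auto simp: inner_edges_iff A_def N_def annulus_def)
      then have "\<rho> x \<le> r" "\<rho> y \<le> r" using dist_edge[OF xy(1)] by auto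
      then show "w x y * (\<bar>f x - f y\<bar> powr p * m x y) = 0" by (simp add: f0)
    qed
    also have "\<dots> \<le> (\<Sum>(x, y)\<in>inner_edges A. real h powr (- p) * (w x y * m x y))"
    proof (rule sum_mono, clarify)
      fix x y assume "(x, y) \<in> inner_edges A"
      then have xy: "{x, y} \<in> E" by (simp add: inner_edges_iff)
      have "\<bar>f x - f y\<bar> powr p \<le> (1 / real h) powr p"
        using lip[OF xy] p_gt_1 by (intro powr_mono2) auto
      also have "\<dots> = real h powr (- p)"
        using h by (simp add: powr_divide powr_minus_divide)
      finally have "\<bar>f x - f y\<bar> powr p * (w x y * m x y) \<le> real h powr (- p) * (w x y * m x y)"
        using weight_nonneg[OF xy] by (intro mult_right_mono) (auto simp: m_def)
      then show "w x y * (\<bar>f x - f y\<bar> powr p * m x y) \<le> real h powr (- p) * (w x y * m x y)"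
        by (simp add: mult_ac)
    qed
    also have "\<dots> = real h powr (- p) * (\<Sum>(x, y)\<in>inner_edges A. w x y * m x y)"
      by (simp add: case_prod_unfold sum_distrib_left)
    also have "\<dots> \<le> real h powr (- p) * (2 * (\<Sum>x\<in>A. \<mu> x * u x powr (p - 1 - e)))"
      unfolding m_def A_def using u_pos
      by (intro mult_left_mono sum_inner_edges_max_le finite_annulus) (auto simp: annulus_def)
    finally have "C * (\<Sum>(x, y)\<in>inner_edges N. w x y * (\<bar>f x - f y\<bar> powr p * m x y))
        \<le> C * (real h powr (- p) * (2 * (\<Sum>x\<in>A. \<mu> x * u x powr (p - 1 - e))))"
      using C by (intro mult_left_mono) auto
    with 1 2 have "(e / 2) * (\<Sum>(x, y)\<in>inner_edges B. w x y * g x y)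
        \<le> C * (real h powr (- p) * (2 * (\<Sum>x\<in>A. \<mu> x * u x powr (p - 1 - e))))"
      by linarith
    then have "(\<Sum>(x, y)\<in>inner_edges B. w x y * g x y)
        \<le> 4 * C / e * real h powr (- p) * (\<Sum>x\<in>A. \<mu> x * u x powr (p - 1 - e))"
      using e by (simp add: field_simps)
    then show "(\<Sum>(x, y)\<in>inner_edges (annulus (r + h) (r + 2 * h)).
         w x y * (max (u x) (u y) powr (- 1 - e) * \<bar>u x - u y\<bar> powr p))
      \<le> 4 * C / e * real h powr (- p) * (\<Sum>x\<in>annulus r (r + 3 * h). \<mu> x * u x powr (p - 1 - e))"
      by (simp only: g_def A_def B_def)
  qed
qed

text \<open>Hoelder's inequality with respect to the vertex measure, on a subset of a ball.\<close>
lemma power_sum_le: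
  assumes A: "A \<subseteq> {x \<in> V. \<rho> x \<le> n}" and s: "0 < s" "s < q"
  shows "(\<Sum>x\<in>A. \<mu> x * u x powr s)
    \<le> (\<Sum>x\<in>A. \<mu> x * u x powr q) powr (s / q) * volume n powr (1 - s / q)"
proof -
  have q: "0 < q" using s by simp
  have "(\<Sum>x\<in>A. \<mu> x * u x powr s)
      = (\<Sum>x\<in>A. (\<mu> x * u x powr q) powr (s / q) * \<mu> x powr (1 - s / q))"
  proof (rule sum.cong[OF refl])
    fix x assume "x \<in> A"
    then have x: "x \<in> V" using A by auto
    have "\<mu> x powr (s / q) * \<mu> x powr (1 - s / q) = \<mu> x"
      using vertex_measure_pos[OF x] by (simp flip: powr_add)
    then show "\<mu> x * u x powr s = (\<mu> x * u x powr q) powr (s / q) * \<mu> x powr (1 - s / q)"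
      using vertex_measure_pos[OF x] q by (simp add: powr_mult powr_powr mult_ac)
  qed
  also have "\<dots> \<le> (\<Sum>x\<in>A. \<mu> x * u x powr q) powr (s / q) * (\<Sum>x\<in>A. \<mu> x) powr (1 - s / q)"
    using s q A vertex_measure_nonneg by (intro Holder_inequality_sum) auto
  also have "\<dots> \<le> (\<Sum>x\<in>A. \<mu> x * u x powr q) powr (s / q) * volume n powr (1 - s / q)"
    using s q A vertex_measure_nonneg
    by (intro mult_left_mono powr_mono2 sum_measure_le_volume sum_nonneg) (auto simp: field_simps)
  finally show ?thesis .
qed

text \<open>The exponents are chosen so that the powers of the maximum of \<open>u\<close> along an edge cancel in the
  product of the two factors.\<close>
lemma flux_Holder:
  assumes A: "finite A" "A \<subseteq> V"
  shows "(\<Sum>(x, y)\<in>inner_edges A. w x y * \<bar>u x - u y\<bar> powr (p - 1))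
    \<le> (\<Sum>(x, y)\<in>inner_edges A. w x y * (max (u x) (u y) powr (- 1 - e) * \<bar>u x - u y\<bar> powr p)) powr ((p - 1) / p)
      * (2 * (\<Sum>x\<in>A. \<mu> x * u x powr ((1 + e) * (p - 1)))) powr (1 / p)"
proof -
  define t where "t = (p - 1) / p"
  have t: "0 < t" "t < 1" "1 - t = 1 / p" using p_gt_1 by (auto simp: t_def field_simps)
  define F where "F = (\<lambda>(x, y). w x y * (max (u x) (u y) powr (- 1 - e) * \<bar>u x - u y\<bar> powr p))"
  define G where "G = (\<lambda>(x, y). w x y * max (u x) (u y) powr ((1 + e) * (p - 1)))"
  have FG: "0 \<le> F i" "0 \<le> G i" if "i \<in> inner_edges A" for i
    using that weight_nonneg by (auto simp: F_def G_def inner_edges_def)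
  have "(\<Sum>(x, y)\<in>inner_edges A. w x y * \<bar>u x - u y\<bar> powr (p - 1))
      = (\<Sum>i\<in>inner_edges A. F i powr t * G i powr (1 - t))"
  proof (rule sum.cong[OF refl], clarify)
    fix x y assume "(x, y) \<in> inner_edges A"
    then have xy: "{x, y} \<in> E" by (simp add: inner_edges_iff)
    define M where "M = max (u x) (u y)"
    have w: "0 < w x y" using xy by (rule weight_pos)
    have M: "0 < M" using u_pos[OF edge_in_V(1)[OF xy]] by (simp add: M_def less_max_iff_disj)
    have "F (x, y) powr t * G (x, y) powr (1 - t)
        = (w x y powr t * w x y powr (1 - t)) * \<bar>u x - u y\<bar> powr (p * t)
          * (M powr ((- 1 - e) * t) * M powr ((1 + e) * (p - 1) * (1 - t)))"
      using w M by (simp add: F_def G_def M_def[symmetric] powr_mult powr_powr mult_ac)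
    also have "w x y powr t * w x y powr (1 - t) = w x y"
      using w by (simp flip: powr_add)
    also have "p * t = p - 1" using p_gt_1 by (simp add: t_def)
    also have "M powr ((- 1 - e) * t) * M powr ((1 + e) * (p - 1) * (1 - t)) = 1"
    proof -
      have "(- 1 - e) * t + (1 + e) * (p - 1) * (1 - t) = 0"
        unfolding t(3) t_def using p_gt_1 by (simp add: field_simps)
      then show ?thesis using M by (simp flip: powr_add)
    qed
    finally show "w x y * \<bar>u x - u y\<bar> powr (p - 1) = F (x, y) powr t * G (x, y) powr (1 - t)" by simp
  qed
  also have "\<dots> \<le> (\<Sum>i\<in>inner_edges A. F i) powr t * (\<Sum>i\<in>inner_edges A. G i) powr (1 - t)"
    using t FG by (intro Holder_inequality_sum) auto
  also have "\<dots> \<le> (\<Sum>i\<in>inner_edges A. F i) powr t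
      * (2 * (\<Sum>x\<in>A. \<mu> x * u x powr ((1 + e) * (p - 1)))) powr (1 - t)"
  proof (intro mult_left_mono powr_mono2)
    show "(\<Sum>i\<in>inner_edges A. G i) \<le> 2 * (\<Sum>x\<in>A. \<mu> x * u x powr ((1 + e) * (p - 1)))"
      unfolding G_def using A u_pos by (intro sum_inner_edges_max_le) auto
  qed (use t FG p_gt_1 in \<open>auto intro: sum_nonneg\<close>)
  finally show ?thesis by (simp add: t(3) F_def) (simp add: t_def)
qed

text \<open>
  The growth estimate. It combines the flux through an annulus with the Caccioppoli inequality; the
  exponents of the two sums that arise are interpolated between 0 and \<open>q\<close>.
\<close>
lemma mass_growth:
  obtains c where "0 < c"
    "\<And>r h n. 0 < h \<Longrightarrow> r + 4 * h \<le> n \<Longrightarrow>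
      mass r + c * volume n * (mass r * real h powr p / volume n) powr (q / (p - 1)) \<le> mass (r + 4 * h)"
proof -
  define k where "k = (p - 1) / q"
  \<comment> \<open>Small enough that both $p - 1 - e$ and $(1 + e)(p - 1)$ lie strictly between 0 and \<open>q\<close>.\<close>
  define e where "e = min ((q - (p - 1)) / (2 * (p - 1))) ((p - 1) / 2)"
  define t where "t = (p - 1) / p"
  have q: "0 < q" using p_gt_1 q_gt by simp
  have k: "0 < k" "k < 1" using p_gt_1 q_gt q by (auto simp: k_def)
  have t: "0 < t" "t < 1" "1 / p = 1 - t" using p_gt_1 by (auto simp: t_def field_simps)
  have e: "0 < e" "0 < p - 1 - e" "p - 1 - e < q" "0 < (1 + e) * (p - 1)" "(1 + e) * (p - 1) < q"
  proof -
    show "0 < e" using p_gt_1 q_gt by (simp add: e_def)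
    have "e \<le> (p - 1) / 2" unfolding e_def by (rule min.cobounded2)
    then show "0 < p - 1 - e" using p_gt_1 by simp
    show "p - 1 - e < q" using \<open>0 < e\<close> q_gt by simp
    show "0 < (1 + e) * (p - 1)" using \<open>0 < e\<close> p_gt_1 by simp
    have "e \<le> (q - (p - 1)) / (2 * (p - 1))" unfolding e_def by (rule min.cobounded1)
    then have "e * (p - 1) \<le> (q - (p - 1)) / 2" using p_gt_1 by (simp add: field_simps)
    then show "(1 + e) * (p - 1) < q" using q_gt by (simp add: algebra_simps)
  qed
  obtain C where C: "0 < C" and cacc: "\<And>r h. 0 < h \<Longrightarrow>
      (\<Sum>(x, y)\<in>inner_edges (annulus (r + h) (r + 2 * h)).
         w x y * (max (u x) (u y) powr (- 1 - e) * \<bar>u x - u y\<bar> powr p))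
      \<le> C * real h powr (- p) * (\<Sum>x\<in>annulus r (r + 3 * h). \<mu> x * u x powr (p - 1 - e))"
    using caccioppoli_annulus[OF e(1)] by blast
  define K where "K = C powr t * 2 powr (1 - t) / 2"
  have K: "0 < K" using C by (simp add: K_def)
  show thesis
  proof
    show "0 < K powr (- (1 / k))" using K by simp
    fix r h n :: nat
    assume h: "0 < h" and n: "r + 4 * h \<le> n"
    define A where "A = annulus r (r + 3 * h)"
    define S where "S s = (\<Sum>x\<in>A. \<mu> x * u x powr s)" for s
    define W where "W = volume n"
    have W: "0 < W" by (simp add: W_def volume_pos)
    have A: "A \<subseteq> {x \<in> V. \<rho> x \<le> n}" using n by (auto simp: A_def annulus_def)
    have S_nonneg: "0 \<le> S s" for s
      unfolding S_def using A vertex_measure_nonneg by (intro sum_nonneg) auto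
    have S_le: "S s \<le> S q powr (s / q) * W powr (1 - s / q)" if "0 < s" "s < q" for s
      unfolding S_def W_def using A that by (rule power_sum_le)
    define X where "X = (\<Sum>(x, y)\<in>inner_edges (annulus (r + h) (r + 2 * h)).
         w x y * (max (u x) (u y) powr (- 1 - e) * \<bar>u x - u y\<bar> powr p))"
    define Y where "Y = (\<Sum>x\<in>annulus (r + h) (r + 2 * h). \<mu> x * u x powr ((1 + e) * (p - 1)))"
    have X_nonneg: "0 \<le> X" unfolding X_def
      using weight_nonneg by (intro sum_nonneg) (auto simp: inner_edges_iff)
    have Y_nonneg: "0 \<le> Y" unfolding Y_def
      using vertex_measure_nonneg by (intro sum_nonneg) (auto simp: annulus_def)
    have Y: "Y \<le> S ((1 + e) * (p - 1))"
      unfolding Y_def S_def using vertex_measure_nonneg finite_annulus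
      by (intro sum_mono2) (auto simp: A_def annulus_def)
    have "2 * real h * mass r \<le> X powr t * (2 * Y) powr (1 - t)"
      using flux_through_annulus[OF h, of r]
        flux_Holder[of "annulus (r + h) (r + 2 * h)" e, OF finite_annulus]
      unfolding X_def[symmetric] Y_def[symmetric] t(3) t_def[symmetric]
      by (auto simp: annulus_def)
    also have "\<dots> \<le> (C * real h powr (- p) * S (p - 1 - e)) powr t * (2 * S ((1 + e) * (p - 1))) powr (1 - t)"
      using cacc[OF h, of r] Y t X_nonneg Y_nonneg unfolding X_def[symmetric] S_def A_def[symmetric]
      by (intro mult_mono powr_mono2) auto
    also have "\<dots> \<le> (C * real h powr (- p) * (S q powr ((p - 1 - e) / q) * W powr (1 - (p - 1 - e) / q))) powr t
        * (2 * (S q powr ((1 + e) * (p - 1) / q) * W powr (1 - (1 + e) * (p - 1) / q))) powr (1 - t)"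
      using S_le[OF e(2,3)] S_le[OF e(4,5)] t C S_nonneg
      by (intro mult_mono powr_mono2 mult_left_mono) auto
    also have "\<dots> = 2 * K * (real h powr (- p * t))
        * (S q powr ((p - 1 - e) / q * t) * S q powr ((1 + e) * (p - 1) / q * (1 - t)))
        * (W powr ((1 - (p - 1 - e) / q) * t) * W powr ((1 - (1 + e) * (p - 1) / q) * (1 - t)))"
      using C W S_nonneg by (simp add: K_def powr_mult powr_powr)
    also have "\<dots> = 2 * K * real h powr (1 - p) * S q powr k * W powr (1 - k)"
    proof -
      have "- p * t = 1 - p" using p_gt_1 by (simp add: t_def)
      moreover have "(p - 1 - e) * t + (1 + e) * (p - 1) * (1 - t) = p - 1"
        unfolding t(3)[symmetric] t_def using p_gt_1 by (simp add: field_simps)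
      then have "(p - 1 - e) / q * t + (1 + e) * (p - 1) / q * (1 - t) = k"
        unfolding k_def by (simp flip: add_divide_distrib)
      moreover from this have "(1 - (p - 1 - e) / q) * t + (1 - (1 + e) * (p - 1) / q) * (1 - t) = 1 - k"
        by (simp add: algebra_simps)
      ultimately show ?thesis
        by (simp only: powr_add[symmetric])
    qed
    finally have "real h * mass r \<le> K * real h powr (1 - p) * S q powr k * W powr (1 - k)"
      by simp
    then have "real h powr (p - 1) * (real h * mass r)
        \<le> real h powr (p - 1) * (K * real h powr (1 - p) * S q powr k * W powr (1 - k))"
      by (intro mult_left_mono) auto
    moreover have "real h powr (p - 1) * (real h * mass r) = mass r * real h powr p"
      using powr_pred_mult_self[of "real h" p] by (simp add: mult_ac)
    moreover have "real h powr (p - 1) * (K * real h powr (1 - p) * S q powr k * W powr (1 - k))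
        = K * S q powr k * W powr (1 - k)"
    proof -
      have "real h powr (p - 1) * real h powr (1 - p) = 1"
        using h by (simp flip: powr_add)
      then show ?thesis by (metis (no_types, opaque_lifting) mult.assoc mult.commute mult_1)
    qed
    ultimately have "mass r * real h powr p \<le> K * S q powr k * W powr (1 - k)" by simp
    then have "mass r * real h powr p / W \<le> K * S q powr k * W powr (1 - k) / W"
      using W by (intro divide_right_mono) auto
    also have "\<dots> = K * S q powr k * W powr (- k)"
      using W by (simp add: powr_diff powr_minus divide_simps)
    finally have "(mass r * real h powr p / W) powr (1 / k) \<le> (K * S q powr k * W powr (- k)) powr (1 / k)"
      using k W mass_nonneg by (intro powr_mono2) auto
    also have "\<dots> = K powr (1 / k) * S q powr 1 * W powr (- 1)"
      using K W k S_nonneg[of q] by (simp add: powr_mult powr_powr)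
    also have "\<dots> = K powr (1 / k) * S q / W"
      using W S_nonneg[of q] by (simp add: powr_minus divide_inverse)
    finally have "K powr (- (1 / k)) * W * (mass r * real h powr p / W) powr (1 / k)
        \<le> K powr (- (1 / k)) * W * (K powr (1 / k) * S q / W)"
      using W by (intro mult_left_mono) auto
    also have "\<dots> = S q"
      using W K by (simp add: powr_minus)
    also have "mass r + S q \<le> mass (r + 4 * h)"
    proof -
      have "{x \<in> V. \<rho> x < r} \<inter> A = {}" "finite {x \<in> V. \<rho> x < r}" "finite A"
        using finite_dist_less finite_annulus
        by (auto simp: A_def annulus_def)
      then have "mass r + S q = (\<Sum>x\<in>{x \<in> V. \<rho> x < r} \<union> A. \<mu> x * u x powr q)"
        unfolding mass_def S_def by (simp add: sum.union_disjoint)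
      also have "\<dots> \<le> mass (r + 4 * h)"
        unfolding mass_def using h vertex_measure_nonneg finite_dist_less
        by (intro sum_mono2) (auto simp: A_def annulus_def)
      finally show ?thesis .
    qed
    moreover have "1 / k = q / (p - 1)" by (simp add: k_def)
    ultimately show "mass r + K powr (- (1 / k)) * volume n * (mass r * real h powr p / volume n) powr (q / (p - 1))
        \<le> mass (r + 4 * h)"
      by (simp add: W_def)
  qed
qed

end

section \<open>Convergence of the volume series\<close>

context superlinear_supersolution
begin

lemma volume_series_finite:
  "(\<Sum>n. ennreal (real (Suc n) powr (p * q / (p - 1) - 1)
            / volume (Suc n) powr ((q - p + 1) / (p - 1)))) < \<infinity>"
proof -
  define \<theta> where "\<theta> = q / (p - 1)"
  have \<theta>: "1 < \<theta>" using p_gt_1 q_gt by (simp add: \<theta>_def)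
  define g where "g i = real i powr (p * \<theta> - 1) / volume i powr (\<theta> - 1)" for i
  have g_nonneg: "0 \<le> g i" for i by (simp add: g_def)
  have exps: "p * q / (p - 1) = p * \<theta>" "(q - p + 1) / (p - 1) = \<theta> - 1"
    using p_gt_1 by (simp_all add: \<theta>_def field_simps)
  obtain c where c: "0 < c" and growth: "\<And>r h n. 0 < h \<Longrightarrow> r + 4 * h \<le> n \<Longrightarrow>
      mass r + c * volume n * (mass r * real h powr p / volume n) powr \<theta> \<le> mass (r + 4 * h)"
    using mass_growth unfolding \<theta>_def by blast
  have mass1: "0 < mass 1" by (rule mass_pos) simp
  obtain B where B: "\<And>m. (\<Sum>k<m. (16 ^ k) powr (p * \<theta>) * volume (16 ^ Suc k) powr (1 - \<theta>)) \<le> B"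
    using dyadic_volume_sum_bounded[of c \<theta> mass volume p,
        OF c \<theta> mass_nonneg mass1 volume_pos mass_le_volume mass_mono growth] by blast
  have "1 * 1 \<le> p * \<theta>" using p_gt_1 \<theta> by (intro mult_mono) auto
  then have p\<theta>: "1 \<le> p * \<theta>" by simp
  define M where "M = (\<Sum>i\<in>{1..<16}. g i) + 16 powr (2 * (p * \<theta>)) * B"
  have bound: "(\<Sum>n<N. g (Suc n)) \<le> M" for N
  proof -
    have N: "N < 16 ^ Suc N" using power_gt_expt[of 16 "Suc N"] by linarith
    have "(\<Sum>n<N. g (Suc n)) = (\<Sum>i\<in>{1..<Suc N}. g i)"
      using sum.shift_bounds_Suc_ivl[of g 0 N] by (simp add: lessThan_atLeast0)
    also have "\<dots> \<le> (\<Sum>i\<in>{1..<16 ^ Suc N}. g i)"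
      using N g_nonneg by (intro sum_mono2) auto
    also have "\<dots> = (\<Sum>i\<in>{1..<16}. g i) + (\<Sum>i\<in>{16..<16 ^ Suc N}. g i)"
      by (rule sum.atLeastLessThan_concat[symmetric]) auto
    also have "(\<Sum>i\<in>{16..<16 ^ Suc N}. g i)
        \<le> 16 powr (2 * (p * \<theta>)) * (\<Sum>k<N. (16 ^ k) powr (p * \<theta>) * volume (16 ^ Suc k) powr (- (\<theta> - 1)))"
      unfolding g_def using p\<theta> \<theta> volume_pos volume_mono by (intro sum_le_condensed_sum) auto
    also have "\<dots> \<le> 16 powr (2 * (p * \<theta>)) * B"
      using B[of N] by (intro mult_left_mono) auto
    finally show ?thesis by (simp add: M_def)
  qed
  have "(\<Sum>n. ennreal (g (Suc n))) \<le> ennreal M"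
    unfolding suminf_eq_SUP
  proof (rule SUP_least)
    fix N
    show "(\<Sum>n<N. ennreal (g (Suc n))) \<le> ennreal M"
      using bound[of N] g_nonneg by (simp add: sum_ennreal ennreal_leI)
  qed
  then show ?thesis
    unfolding exps g_def by (rule le_less_trans) (simp add: ennreal_less_top)
qed

end


section \<open>Vanishing of nonnegative supersolutions\<close>

text \<open>At a zero of \<open>u\<close> all terms of the $p$-Laplacian are nonnegative, but their sum is not positive.\<close>
lemma (in locally_finite_weighted_graph) zero_propagates:
  assumes u: "\<And>y. y \<in> V \<Longrightarrow> 0 \<le> u y"
    and super: "0 \<le> - p_laplacian E w p u x"
    and xy: "{x, y} \<in> E" and x: "u x = 0"
  shows "u y = 0"
proof -
  have xV: "x \<in> V" using edge_in_V(1)[OF xy] .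
  have nonneg: "0 \<le> w x y * Phi p (u y - u x)" if "y \<in> neighbours E x" for y
    using that u[OF edge_in_V(2)] weight_nonneg x by (simp add: neighbours_def Phi_def)
  have "(\<Sum>y\<in>neighbours E x. w x y * Phi p (u y - u x)) \<le> 0"
    using super vertex_measure_pos[OF xV] by (simp add: p_laplacian_def divide_le_0_iff)
  then have "(\<Sum>y\<in>neighbours E x. w x y * Phi p (u y - u x)) = 0"
    by (intro order_antisym sum_nonneg nonneg)
  then have "w x y * Phi p (u y - u x) = 0"
    using sum_nonneg_eq_0_iff[OF finite_neighbours[OF xV] nonneg] xy by (simp add: neighbours_def)
  then show ?thesis
    using weight_pos[OF xy] x by (auto simp: Phi_def)
qed

theorem theorem1p2:
  fixes V :: "'a set" and E :: "'a set set" and w :: "'a \<Rightarrow> 'a \<Rightarrow> real"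
    and p q :: real and z :: 'a and u :: "'a \<Rightarrow> real"
  assumes "1 < p" and "q > p - 1"
    and "weighted_graph V E w"
    and "infinite V"
    and "connected_graph V E"
    and "locally_finite_graph V E"
    and "\<not> p_parabolic V E w p"
    and "z \<in> V"
    and "(\<Sum>n. ennreal (real (Suc n) powr (p * q / (p - 1) - 1)
            / set_measure E w (graph_ball V E z (Suc n)) powr ((q - p + 1) / (p - 1)))) = \<infinity>"
    and "\<forall>x\<in>V. u x \<ge> 0"
    and "\<forall>x\<in>V. - p_laplacian E w p u x \<ge> u x powr q"
  shows "\<forall>x\<in>V. u x = 0"
proof -
  interpret weighted_graph V E w by fact
  interpret locally_finite_weighted_graph V E w z
    using assms by unfold_locales auto
  show ?thesis
  proof (cases "\<exists>x\<in>V. u x = 0")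
    case True
    then obtain x where x: "x \<in> V" "u x = 0" by blast
    show ?thesis
    proof
      fix y assume "y \<in> V"
      then have "(x, y) \<in> (adjacency E)\<^sup>*"
        using x assms(5) by (simp add: connected_graph_def)
      then show "u y = 0"
      proof (induction rule: rtrancl_induct)
        case (step a b)
        then have ab: "{a, b} \<in> E" by (simp add: adjacency_def)
        have "0 \<le> - p_laplacian E w p u a"
          using assms(11) edge_in_V(1)[OF ab] by (meson order_trans powr_ge_zero)
        then show ?case
          using zero_propagates[where p = p and u = u and x = a and y = b] assms(10) ab step.IH by blast
      qed (rule x)
    qed
  next
    case False
    then have "0 < u x" if "x \<in> V" for x
      using assms(10) that by (metis order_le_less)
    then interpret superlinear_supersolution V E w z p q u
      using assms by unfold_locales auto
    show ?thesis
      using volume_series_finite assms(9) by (simp add: volume_def)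
  qed
qed

end
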